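(* Let $X$, $Y$ be Banach spaces over $\mathbb{K}$, and let $T,A\in\mathcal{K}(X,Y)$. Then $$T\perp_B A\iff 0\in\operatorname{conv}\bigl(\{x^{**}(A^*(y^* ))\colon x^{**}\in\operatorname{ext}(B_{X^{**}}),\ y^*\in\operatorname{ext}(B_{Y^*}),\ x^{**}(T^*(y^* ))=\|T\|\}\bigr).$$
   Context: $\mathbb{K}$ is $\mathbb{R}$ or $\mathbb{C}$. $\mathcal{K}(X,Y)$ is the space of compact linear operators from $X$ to $Y$ with the operator norm; $T^*\colon Y^*\to X^*$ is the adjoint. $B_{X^{**}}$, $B_{Y^*}$ are the closed unit balls of $X^{**}$, $Y^*$, $\operatorname{ext}$ denotes the set of extreme points and $\operatorname{conv}$ the convex hull. $x\perp_B y$ (Birkhoff-James orthogonality) means $\|x+\lambda y\|\geq\|x\|$ for all $\lambda\in\mathbb{K}$. *)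

theory Defs
  imports "HOL-Analysis.Analysis" "HOL-Library.Function_Algebras"
begin

section \<open>The scalar field\<close>

definition (in real_normed_field) isometric_field_iso :: "('a \<Rightarrow> 'b::real_normed_field) \<Rightarrow> bool" where
  "isometric_field_iso h \<longleftrightarrow>
     bij h \<and> (\<forall>x y. h (x + y) = h x + h y) \<and> (\<forall>x y. h (x * y) = h x * h y) \<and>
     h 1 = 1 \<and> (\<forall>x. norm (h x) = norm x)"

text \<open>
  A type of this class is a copy of the real or of the complex field, with its absolute value.
  It allows \<open>\<bbbK>\<close> to be a type variable; \<^typ>\<open>real\<close> and \<^typ>\<open>complex\<close> are instances.
\<close>

class real_or_complex = real_normed_field +
  assumes real_or_complex:
    "(\<exists>h::'a \<Rightarrow> real. isometric_field_iso h) \<or> (\<exists>h::'a \<Rightarrow> complex. isometric_field_iso h)"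

lemma isometric_field_iso_id: "isometric_field_iso (\<lambda>x. x)"
  by (simp add: isometric_field_iso_def bij_def inj_def surj_def)

instance real :: real_or_complex
  by standard (use isometric_field_iso_id in blast)

instance complex :: real_or_complex
  by standard (use isometric_field_iso_id in blast)


section \<open>Banach spaces over \<open>\<bbbK>\<close>\<close>

text \<open>
  A Banach space over \<open>\<bbbK>\<close> is a type of class \<^class>\<open>banach\<close> (which supplies addition, norm,
  completeness and multiplication by real scalars) with a scalar multiplication by \<open>\<bbbK>\<close> that
  extends the real one and for which the norm is absolutely homogeneous.
\<close>

locale banach_over = vector_space scale
  for scale :: "'k::real_or_complex \<Rightarrow> 'a::banach \<Rightarrow> 'a" +
  assumes scale_of_real: "scale (of_real r) x = r *\<^sub>R x"
    and norm_scale: "norm (scale c x) = norm c * norm x"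

lemma banach_over_scaleR: "banach_over ((*\<^sub>R) :: real \<Rightarrow> 'a::banach \<Rightarrow> 'a)"
  by unfold_locales (simp_all add: algebra_simps)

lemma banach_over_complex: "banach_over ((*) :: complex \<Rightarrow> complex \<Rightarrow> complex)"
  by unfold_locales (simp_all add: algebra_simps norm_mult scaleR_conv_of_real)


section \<open>Bounded operators and Birkhoff-James orthogonality\<close>

text \<open>
  Elements of \<^typ>\<open>'a \<Rightarrow>\<^sub>L 'b\<close> are bounded real-linear maps, and their norm is the operator norm;
  linearity over \<open>\<bbbK>\<close> is a condition on top of that. With \<^term>\<open>(*)\<close> as scalar multiplication
  on the target one obtains the dual space.
\<close>

definition bounded_ops ::
    "('k \<Rightarrow> 'a \<Rightarrow> 'a) \<Rightarrow> ('k \<Rightarrow> 'b \<Rightarrow> 'b) \<Rightarrow> ('a::real_normed_vector \<Rightarrow>\<^sub>L 'b::real_normed_vector) set"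
  where "bounded_ops sX sY = {T. \<forall>c x. blinfun_apply T (sX c x) = sY c (blinfun_apply T x)}"

definition compact_ops ::
    "('k \<Rightarrow> 'a \<Rightarrow> 'a) \<Rightarrow> ('k \<Rightarrow> 'b \<Rightarrow> 'b) \<Rightarrow> ('a::real_normed_vector \<Rightarrow>\<^sub>L 'b::real_normed_vector) set"
  where "compact_ops sX sY =
    {T \<in> bounded_ops sX sY. compact (closure (blinfun_apply T ` cball 0 1))}"

definition op_scale ::
    "('k \<Rightarrow> 'b \<Rightarrow> 'b) \<Rightarrow> 'k \<Rightarrow> ('a::real_normed_vector \<Rightarrow>\<^sub>L 'b::real_normed_vector) \<Rightarrow> ('a \<Rightarrow>\<^sub>L 'b)"
  where "op_scale sY c T = Blinfun (\<lambda>x. sY c (blinfun_apply T x))"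

lemma (in banach_over) bounded_linear_scale: "bounded_linear (scale c)"
proof (rule bounded_linear_intro[where K = "norm c"])
  show "scale c (r *\<^sub>R x) = r *\<^sub>R scale c x" for r x
    by (metis scale_of_real scale_left_commute)
qed (simp_all add: scale_right_distrib norm_scale mult.commute)

lemma (in banach_over) op_scale_apply [simp]:
  "blinfun_apply (op_scale scale c T) x = scale c (blinfun_apply T x)"
  unfolding op_scale_def
  by (subst bounded_linear_Blinfun_apply)
    (auto intro: bounded_linear_compose[OF bounded_linear_scale] blinfun.bounded_linear_right)

lemma op_scale_mult_apply [simp]:
  "blinfun_apply (op_scale (*) c f) x = (c::'k::real_normed_algebra) * blinfun_apply f x"
  unfolding op_scale_def
  by (subst bounded_linear_Blinfun_apply)
    (auto intro: bounded_linear_const_mult blinfun.bounded_linear_right)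

definition birkhoff_orthogonal :: "('k \<Rightarrow> 'v \<Rightarrow> 'v) \<Rightarrow> 'v::real_normed_vector \<Rightarrow> 'v \<Rightarrow> bool"
  where "birkhoff_orthogonal s x y \<longleftrightarrow> (\<forall>c. norm (x + s c y) \<ge> norm x)"


section \<open>Dual, adjoint and bidual\<close>

definition dual :: "('k \<Rightarrow> 'a \<Rightarrow> 'a) \<Rightarrow> ('a::real_normed_vector \<Rightarrow>\<^sub>L 'k::real_or_complex) set"
  where "dual sX = bounded_ops sX (*)"

definition dual_ball :: "('k \<Rightarrow> 'a \<Rightarrow> 'a) \<Rightarrow> ('a::real_normed_vector \<Rightarrow>\<^sub>L 'k::real_or_complex) set"
  where "dual_ball sX = {f \<in> dual sX. norm f \<le> 1}"

definition banach_adjoint ::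
    "('a::real_normed_vector \<Rightarrow>\<^sub>L 'b::real_normed_vector)
      \<Rightarrow> ('b \<Rightarrow>\<^sub>L 'k::real_normed_vector) \<Rightarrow> ('a \<Rightarrow>\<^sub>L 'k)"
  where "banach_adjoint T f = f o\<^sub>L T"

lemma banach_adjoint_in_dual:
  "T \<in> bounded_ops sX sY \<Longrightarrow> f \<in> dual sY \<Longrightarrow> banach_adjoint T f \<in> dual sX"
  by (simp add: bounded_ops_def dual_def banach_adjoint_def)

text \<open>
  The dual is in general a proper subset of its type when \<open>\<bbbK>\<close> is complex, so elements of the bidual are
  functions that are constrained on the dual only. The value 0 elsewhere makes the representing
  function unique.
\<close>

definition bidual ::
    "('k \<Rightarrow> 'a \<Rightarrow> 'a) \<Rightarrow> (('a::real_normed_vector \<Rightarrow>\<^sub>L 'k::real_or_complex) \<Rightarrow> 'k) set"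
  where "bidual sX = {\<phi>.
    (\<forall>f\<in>dual sX. \<forall>g\<in>dual sX. \<phi> (f + g) = \<phi> f + \<phi> g) \<and>
    (\<forall>c. \<forall>f\<in>dual sX. \<phi> (op_scale (*) c f) = c * \<phi> f) \<and>
    (\<exists>B. \<forall>f\<in>dual sX. norm (\<phi> f) \<le> B * norm f) \<and>
    (\<forall>f. f \<notin> dual sX \<longrightarrow> \<phi> f = 0)}"

definition bidual_norm ::
    "('k \<Rightarrow> 'a \<Rightarrow> 'a) \<Rightarrow> (('a::real_normed_vector \<Rightarrow>\<^sub>L 'k::real_or_complex) \<Rightarrow> 'k) \<Rightarrow> real"
  where "bidual_norm sX \<phi> = (SUP f\<in>dual_ball sX. norm (\<phi> f))"

definition bidual_ball ::
    "('k \<Rightarrow> 'a \<Rightarrow> 'a) \<Rightarrow> (('a::real_normed_vector \<Rightarrow>\<^sub>L 'k::real_or_complex) \<Rightarrow> 'k) set"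
  where "bidual_ball sX = {\<phi> \<in> bidual sX. bidual_norm sX \<phi> \<le> 1}"

text \<open>The pointwise real vector space structure, so that \<^const>\<open>extreme_point_of\<close> applies to
  sets of functions.\<close>

instantiation "fun" :: (type, real_vector) real_vector
begin

definition scaleR_fun :: "real \<Rightarrow> ('a \<Rightarrow> 'b) \<Rightarrow> 'a \<Rightarrow> 'b"
  where "scaleR_fun r f = (\<lambda>x. r *\<^sub>R f x)"

instance
  by standard (simp_all add: scaleR_fun_def fun_eq_iff plus_fun_def algebra_simps)

end

lemma (in banach_over) bidual_ball_iff:
  "\<phi> \<in> bidual_ball scale \<longleftrightarrow>
     \<phi> \<in> bidual scale \<and> (\<forall>f\<in>dual scale. norm (\<phi> f) \<le> norm f)"
proof (cases "\<phi> \<in> bidual scale")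
  case True
  then obtain B where B: "\<And>f. f \<in> dual scale \<Longrightarrow> norm (\<phi> f) \<le> B * norm f"
    and hom: "\<And>c f. f \<in> dual scale \<Longrightarrow> \<phi> (op_scale (*) c f) = c * \<phi> f"
    unfolding bidual_def by blast
  have "norm (\<phi> f) \<le> \<bar>B\<bar>" if "f \<in> dual_ball scale" for f
  proof -
    have "norm (\<phi> f) \<le> \<bar>B\<bar> * norm f"
      using B[of f] that by (simp add: dual_ball_def) (smt (verit) mult_right_mono norm_ge_zero)
    also have "\<dots> \<le> \<bar>B\<bar> * 1"
      using that by (intro mult_left_mono) (auto simp: dual_ball_def)
    finally show ?thesis by simp
  qed
  then have bdd: "bdd_above ((\<lambda>f. norm (\<phi> f)) ` dual_ball scale)"
    by (intro bdd_aboveI2)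
  have "0 \<in> dual_ball scale"
    by (simp add: dual_ball_def dual_def bounded_ops_def)
  then have ne: "dual_ball scale \<noteq> {}" by blast
  have iff1: "bidual_norm scale \<phi> \<le> 1 \<longleftrightarrow> (\<forall>f\<in>dual_ball scale. norm (\<phi> f) \<le> 1)"
    unfolding bidual_norm_def by (rule cSUP_le_iff[OF ne bdd])
  have "norm (\<phi> f) \<le> norm f"
    if H: "\<forall>f\<in>dual_ball scale. norm (\<phi> f) \<le> 1" and f: "f \<in> dual scale" for f
  proof (cases "f = 0")
    case True
    then show ?thesis using B[OF f] by simp
  next
    case False
    define c :: 'k where "c = of_real (inverse (norm f))"
    let ?g = "op_scale (*) c f"
    have geq: "?g = inverse (norm f) *\<^sub>R f"
      by (rule blinfun_eqI) (simp add: c_def scaleR_conv_of_real blinfun.scaleR_left)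
    have "?g \<in> dual scale"
      using f by (simp add: dual_def bounded_ops_def algebra_simps)
    moreover have "norm ?g \<le> 1"
      using False by (simp add: geq)
    ultimately have "norm (\<phi> ?g) \<le> 1"
      using H by (simp add: dual_ball_def)
    then show ?thesis
      using False by (simp add: hom[OF f] norm_mult c_def norm_divide field_simps)
  qed
  moreover have "norm (\<phi> f) \<le> 1"
    if "\<forall>f\<in>dual scale. norm (\<phi> f) \<le> norm f" "f \<in> dual_ball scale" for f
    using that by (force simp: dual_ball_def)
  ultimately show ?thesis
    using True iff1 by (auto simp: bidual_ball_def)
qed (simp add: bidual_ball_def)

end

theory Submission
  imports Defs
begin

text \<open>Each element \<open>\<phi> (A\<^sup>* f)\<close> of the set satisfies \<open>\<parallel>T\<parallel> + Re (c \<phi> (A\<^sup>* f)) \<le> \<parallel>T + c A\<parallel>\<close>, a convex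
  condition, so 0 in the hull gives orthogonality. Conversely, drop extremality and let \<open>D\<close> be
  the set of values \<open>\<phi> (A\<^sup>* f)\<close> where \<open>f\<close> is in the unit ball and \<open>\<phi>\<close> is a weak* limit of points
  of the unit ball of \<open>X\<close>, with \<open>\<phi> (T\<^sup>* f) = \<parallel>T\<parallel>\<close>. As \<open>T\<close> and \<open>A\<close> are compact, \<open>D\<close> is
  compact; if its hull missed 0, then some scalar \<open>c\<close> would have \<open>Re (c d) > \<delta> > 0\<close> on \<open>D\<close>, and
  near-norming pairs of \<open>T - \<epsilon> c A\<close> would accumulate, as \<open>\<epsilon> \<rightarrow> 0\<close>, at a point of \<open>D\<close> violating
  this. Finally, \<open>D\<close> lies in the hull of the extreme values: the functionals that attain
  \<open>\<parallel>T\<parallel>\<close> form a weak* closed face, whose image under the evaluation into the scalars is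
  the hull of its extreme points, and these lift to extreme points of the face by Krein-Milman.
  This is applied first to \<open>f\<close> and then to \<open>\<phi>\<close>.\<close>

section \<open>Embedding the scalar field into the complex numbers\<close>

text \<open>The last conjunct says that every real-linear functional on the scalars is
  \<open>Re\<close> of multiplication by a fixed scalar. It holds for both fields, so later
  arguments need no case distinction.\<close>

definition embeds_in_complex :: "('k::real_normed_field \<Rightarrow> complex) \<Rightarrow> bool" where
  "embeds_in_complex j \<longleftrightarrow> linear j \<and> (\<forall>x. norm (j x) = norm x) \<and> (\<forall>x y. j (x * y) = j x * j y) \<and>
     j 1 = 1 \<and> (\<forall>r. linear r \<longrightarrow> (\<exists>w. \<forall>c. r c = Re (j (c * w))))"

text \<open>Linearity over the reals follows because an isometric ring isomorphism preserves the
  distances of a real number to 0 and 1.\<close>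

lemma complex_eq_of_real_if_norms:
  fixes z :: complex
  assumes "norm z = \<bar>t\<bar>" "norm (z - 1) = \<bar>t - 1\<bar>"
  shows "z = of_real t"
proof -
  have 1: "(Re z)\<^sup>2 + (Im z)\<^sup>2 = t\<^sup>2"
    using arg_cong[OF assms(1), of "\<lambda>x. x\<^sup>2"] by (simp add: cmod_power2)
  have "(Re z - 1)\<^sup>2 + (Im z)\<^sup>2 = (t - 1)\<^sup>2"
    using arg_cong[OF assms(2), of "\<lambda>x. x\<^sup>2"] by (simp add: cmod_power2)
  with 1 have "Re z = t" by (simp add: power2_diff)
  with 1 show ?thesis by (simp add: complex_eq_iff)
qed

lemma isometric_ring_hom_linear:
  fixes j :: "'k::real_normed_field \<Rightarrow> complex"
  assumes add: "\<And>x y. j (x + y) = j x + j y" and mult: "\<And>x y. j (x * y) = j x * j y"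
    and one: "j 1 = 1" and norm: "\<And>x. norm (j x) = norm x"
  shows "linear j"
proof (rule linearI)
  have diff: "j (x - y) = j x - j y" for x y
    using add[of "x - y" y] by simp
  have of_real: "j (of_real t) = of_real t" for t
  proof (rule complex_eq_of_real_if_norms)
    show "norm (j (of_real t)) = \<bar>t\<bar>" by (simp add: norm)
    have "norm (j (of_real t) - 1) = norm (j (of_real t - 1))"
      by (simp only: diff one)
    also have "\<dots> = norm (of_real t - 1 :: 'k)"
      by (rule norm)
    also have "\<dots> = \<bar>t - 1\<bar>" by (metis norm_of_real of_real_1 of_real_diff)
    finally show "norm (j (of_real t) - 1) = \<bar>t - 1\<bar>" .
  qed
  show "j (r *\<^sub>R x) = r *\<^sub>R j x" for r x
    by (simp add: scaleR_conv_of_real mult of_real)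
qed (rule add)

lemma embeds_in_complex_ex: "\<exists>j::'k::real_or_complex \<Rightarrow> complex. embeds_in_complex j"
  using real_or_complex
proof (elim disjE exE)
  fix h :: "'k \<Rightarrow> real" assume h: "isometric_field_iso h"
  define j where "j = complex_of_real \<circ> h"
  have lin: "linear j"
    by (rule isometric_ring_hom_linear)
      (use h in \<open>simp_all add: j_def isometric_field_iso_def\<close>)
  have "\<exists>w. \<forall>c. r c = Re (j (c * w))" if r: "linear r" for r :: "'k \<Rightarrow> real"
  proof -
    \<comment> \<open>Both sides have the same image under the injective \<open>h\<close>. So every
      scalar is a real multiple of 1, and \<open>r\<close> is determined by
      \<open>r 1\<close>.\<close>
    have "of_real (h c) = c" for c
    proof -
      have "j 1 = 1" using h by (simp add: j_def isometric_field_iso_def)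
      then have "j (of_real (h c)) = of_real (h c)"
        using linear_scale[OF lin, of "h c" 1] by (simp add: scaleR_conv_of_real)
      then have "h (of_real (h c)) = h c" by (simp add: j_def)
      then show ?thesis
        using h by (simp add: isometric_field_iso_def bij_def inj_eq)
    qed
    then have c: "c = h c *\<^sub>R 1" for c by (simp add: scaleR_conv_of_real)
    have "r c = Re (j (c * (r 1 *\<^sub>R 1)))" for c
    proof -
      have "r c = h c * r 1"
        using linear_scale[OF r, of "h c" 1] c[of c] by simp
      moreover have "j (c * (r 1 *\<^sub>R 1)) = r 1 *\<^sub>R j c"
        using linear_scale[OF lin, of "r 1" c] by simp
      ultimately show ?thesis by (simp add: j_def)
    qed
    then show ?thesis by blast
  qed
  then have "embeds_in_complex j"
    using h lin unfolding embeds_in_complex_def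
    by (simp add: j_def isometric_field_iso_def)
  then show ?thesis by blast
next
  fix j :: "'k \<Rightarrow> complex" assume h: "isometric_field_iso j"
  have lin: "linear j"
    by (rule isometric_ring_hom_linear)
      (use h in \<open>simp_all add: isometric_field_iso_def\<close>)
  have "\<exists>w. \<forall>c. r c = Re (j (c * w))" if r: "linear r" for r :: "'k \<Rightarrow> real"
  proof -
    have bij: "bij j" and mult: "\<And>x y. j (x * y) = j x * j y" and one: "j 1 = 1"
      using h by (auto simp: isometric_field_iso_def)
    \<comment> \<open>As \<open>Re ((a + ib)(u + iv)) = au - bv\<close>, the choice
      \<open>u = r 1\<close>, \<open>v = - r i\<close> reproduces \<open>r\<close>.\<close>
    obtain i w where i: "j i = \<i>" and w: "j w = Complex (r 1) (- r i)"
      using bij by (metis bij_pointE)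
    have "r c = Re (j (c * w))" for c
    proof -
      have "c = Re (j c) *\<^sub>R 1 + Im (j c) *\<^sub>R i"
        by (rule bij_is_inj[OF bij, THEN injD])
          (simp add: linear_add[OF lin] linear_scale[OF lin] one i complex_eq_iff)
      then have "r c = r (Re (j c) *\<^sub>R 1 + Im (j c) *\<^sub>R i)" by simp
      also have "\<dots> = Re (j c) * r 1 + Im (j c) * r i"
        by (simp add: linear_add[OF r] linear_scale[OF r])
      finally show ?thesis by (simp add: mult w)
    qed
    then show ?thesis by blast
  qed
  then have "embeds_in_complex j"
    using h lin unfolding embeds_in_complex_def by (simp add: isometric_field_iso_def)
  then show ?thesis by blast
qed

section \<open>A fixed embedding and real parts of scalars\<close>

definition cembed :: "'k::real_or_complex \<Rightarrow> complex"
  where "cembed = (SOME j. embeds_in_complex j)"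

lemma embeds_in_complex_cembed: "embeds_in_complex cembed"
  unfolding cembed_def by (rule someI_ex[OF embeds_in_complex_ex])

lemma linear_cembed: "linear cembed"
  and norm_cembed [simp]: "norm (cembed x) = norm x"
  and cembed_1 [simp]: "cembed 1 = 1"
  using embeds_in_complex_cembed by (auto simp: embeds_in_complex_def)

lemma cembed_add [simp]: "cembed (x + y) = cembed x + cembed y"
  and cembed_diff [simp]: "cembed (x - y) = cembed x - cembed y"
  and cembed_scaleR [simp]: "cembed (r *\<^sub>R x) = r *\<^sub>R cembed x"
  by (simp_all add: linear_add[OF linear_cembed] linear_diff[OF linear_cembed]
      linear_scale[OF linear_cembed])

lemma cembed_of_real [simp]: "cembed (of_real r) = of_real r"
  using cembed_scaleR[of r 1] by (simp add: scaleR_conv_of_real)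

lemma bounded_linear_cembed: "bounded_linear cembed"
  by (rule bounded_linear_intro[where K = 1]) auto

lemmas continuous_on_cembed [continuous_intros] =
  bounded_linear.continuous_on[OF bounded_linear_cembed]

lemma inj_cembed: "inj cembed"
  by (rule injI) (metis cembed_diff eq_iff_diff_eq_0 norm_cembed norm_eq_zero)

definition re :: "'k::real_or_complex \<Rightarrow> real"
  where "re x = Re (cembed x)"

lemma re_add [simp]: "re (x + y) = re x + re y"
  and re_diff [simp]: "re (x - y) = re x - re y"
  and re_scaleR [simp]: "re (r *\<^sub>R x) = r * re x"
  and re_of_real [simp]: "re (of_real r) = r"
  and re_le_norm: "re x \<le> norm x"
  using complex_Re_le_cmod[of "cembed x"] by (simp_all add: re_def)

lemma linear_re: "linear re"
  by (rule linearI) auto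

lemma continuous_on_re [continuous_intros]:
  "continuous_on S f \<Longrightarrow> continuous_on S (\<lambda>x. re (f x))"
  unfolding re_def by (intro continuous_intros)

lemma linear_functional_re_mult:
  fixes r :: "'k::real_or_complex \<Rightarrow> real"
  assumes "linear r"
  obtains w where "\<And>c. r c = re (c * w)"
  using embeds_in_complex_cembed assms by (auto simp: embeds_in_complex_def re_def)

text \<open>A complex number whose real part equals its modulus has no imaginary part. This turns
  the condition of attaining the norm into a real-linear one, which cuts out a face.\<close>

lemma eq_of_real_if_re_ge_norm:
  assumes "norm x \<le> m" "re x \<ge> m"
  shows "x = of_real m"
proof (rule injD[OF inj_cembed])
  have Re: "Re (cembed x) = m"
    using assms re_le_norm[of x] by (simp add: re_def)
  have "norm (cembed x) = m"
    using assms re_le_norm[of x] by simp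
  then have "Im (cembed x) = 0"
    using Re cmod_power2[of "cembed x"] by simp
  with Re show "cembed x = cembed (of_real m)"
    by (simp add: complex_eq_iff)
qed

lemma ex_rotation:
  fixes w :: "'k::real_normed_field"
  obtains c where "norm c = 1" "c * w = of_real (norm w)"
proof (cases "w = 0")
  case True
  then show ?thesis using that[of 1] by simp
next
  case False
  then show ?thesis using that[of "of_real (norm w) / w"] by (simp add: norm_divide)
qed

text \<open>Compactness is pulled back from the complex plane: the image of the ball is closed and
  bounded, since the range is a real subspace, and the inverse of \<open>cembed\<close> is isometric
  there.\<close>

lemma compact_cball_scalar: "compact (cball (0::'k::real_or_complex) r)"
proof -
  have im: "cembed ` cball (0::'k) r = range (cembed :: 'k \<Rightarrow> complex) \<inter> cball 0 r"
    by auto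
  have "closed (range (cembed :: 'k \<Rightarrow> complex))"
    by (intro closed_subspace linear_subspace_image linear_cembed subspace_UNIV)
  then have "compact (cembed ` cball (0::'k) r)"
    unfolding im by (intro closed_Int_compact compact_cball)
  moreover have "continuous_on (cembed ` cball (0::'k) r) (inv cembed :: complex \<Rightarrow> 'k)"
    unfolding continuous_on_iff
  proof (intro ballI allI impI)
    fix x e :: "_" assume "x \<in> cembed ` cball (0::'k) r" "0 < (e::real)"
    then show "\<exists>d>0. \<forall>x'\<in>cembed ` cball (0::'k) r. dist x' x < d \<longrightarrow> dist (inv cembed x' :: 'k) (inv cembed x) < e"
      by (intro exI[of _ e]) (auto simp: inv_f_f[OF inj_cembed] dist_norm simp flip: cembed_diff)
  qed
  ultimately have "compact ((inv cembed :: complex \<Rightarrow> 'k) ` (cembed ` cball (0::'k) r))"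
    by (rule compact_continuous_image[rotated])
  then show ?thesis
    by (simp add: image_image inv_f_f[OF inj_cembed])
qed

section \<open>Extreme points of compact convex sets\<close>

text \<open>A proper convex combination of two numbers that are at most \<open>m\<close> can equal
  \<open>m\<close> only if both do.\<close>

lemma face_of_linear_max:
  fixes r :: "'v::real_vector \<Rightarrow> real"
  assumes "convex C" "linear r" "\<And>v. v \<in> C \<Longrightarrow> r v \<le> m"
  shows "{v\<in>C. r v = m} face_of C"
  unfolding face_of_def
proof (intro conjI ballI impI)
  have "{v\<in>C. r v = m} = C \<inter> r -` {m}" by blast
  then show "convex {v\<in>C. r v = m}"
    by (simp add: assms convex_Int convex_linear_vimage)
  fix a b x assume ab: "a \<in> C" "b \<in> C" and x: "x \<in> {v\<in>C. r v = m}" "x \<in> open_segment a b"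
  then obtain u where u: "0 < u" "u < 1" "x = (1 - u) *\<^sub>R a + u *\<^sub>R b"
    by (auto simp: in_segment)
  then have "r x = (1 - u) * r a + u * r b"
    using assms(2) by (simp add: linear_add linear_scale)
  then have "(1 - u) * (m - r a) + u * (m - r b) = 0"
    using x(1) by (simp add: algebra_simps)
  moreover have "(1 - u) * (m - r a) \<ge> 0" "u * (m - r b) \<ge> 0"
    using u assms(3) ab by simp_all
  ultimately have "(1 - u) * (m - r a) = 0" "u * (m - r b) = 0" by linarith+
  then show "a \<in> {v\<in>C. r v = m}" "b \<in> {v\<in>C. r v = m}" using u ab by simp_all
qed auto

text \<open>An open segment meeting the fibre is mapped to a segment through the extreme point
  \<open>p\<close>, which must therefore degenerate. An extreme point of the fibre is then one of
  \<open>C\<close>.\<close>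

lemma face_of_linear_preimage_extreme_point:
  assumes "convex C" "linear q" "p extreme_point_of (q ` C)"
  shows "{v\<in>C. q v = p} face_of C"
  unfolding face_of_def
proof (intro conjI ballI impI)
  have "{v\<in>C. q v = p} = C \<inter> q -` {p}" by blast
  then show "convex {v\<in>C. q v = p}"
    by (simp add: assms convex_Int convex_linear_vimage)
  fix a b x assume ab: "a \<in> C" "b \<in> C" and x: "x \<in> {v\<in>C. q v = p}" "x \<in> open_segment a b"
  then obtain u where u: "0 < u" "u < 1" "x = (1 - u) *\<^sub>R a + u *\<^sub>R b"
    by (auto simp: in_segment)
  then have "q x = (1 - u) *\<^sub>R q a + u *\<^sub>R q b"
    using assms(2) by (simp add: linear_add linear_scale)
  then have p: "p = (1 - u) *\<^sub>R q a + u *\<^sub>R q b"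
    using x(1) by simp
  have "q a = q b"
  proof (rule ccontr)
    assume "q a \<noteq> q b"
    then have "p \<in> open_segment (q a) (q b)"
      using u p by (auto simp: in_segment)
    then show False using assms(3) ab by (auto simp: extreme_point_of_def)
  qed
  then have "q a = p" "q b = p" using p by (simp_all flip: scaleR_left_distrib)
  then show "a \<in> {v\<in>C. q v = p}" "b \<in> {v\<in>C. q v = p}" using ab by simp_all
qed auto

text \<open>In a minimal nonempty closed face every continuous linear functional is constant.\<close>

lemma extreme_point_exists:
  fixes C :: "'v::{real_vector,topological_space} set" and L :: "('v \<Rightarrow> real) set"
  assumes C: "compact C" "closed C" "convex C" "C \<noteq> {}"
    and L: "\<And>l. l \<in> L \<Longrightarrow> linear l" "\<And>l. l \<in> L \<Longrightarrow> continuous_on UNIV l"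
    and sep: "\<And>x y. (\<And>l. l \<in> L \<Longrightarrow> l x = l y) \<Longrightarrow> x = y"
  shows "\<exists>e. e extreme_point_of C"
proof -
  define \<F> where "\<F> = {F. F face_of C \<and> closed F \<and> F \<noteq> {}}"
  have CF: "C \<in> \<F>"
    using C by (simp add: \<F>_def face_of_refl)
  have "\<exists>M\<in>\<F>. \<forall>F\<in>\<F>. M \<supseteq> F \<longrightarrow> F = M"
  proof (rule predicate_Zorn)
    show "partial_order_on \<F> (relation_of (\<lambda>A B. A \<supseteq> B) \<F>)"
      by (rule partial_order_on_relation_ofI) (rule order_refl, erule (1) order_trans, erule (1) antisym)
    fix c assume "c \<in> Chains (relation_of (\<lambda>A B. A \<supseteq> B) \<F>)"
    then have c: "c \<subseteq> \<F>" "\<And>A B. A \<in> c \<Longrightarrow> B \<in> c \<Longrightarrow> A \<subseteq> B \<or> B \<subseteq> A"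
      by (auto simp: Chains_def relation_of_def)
    show "\<exists>U\<in>\<F>. \<forall>A\<in>c. A \<supseteq> U"
    proof (cases "c = {}")
      case True
      then show ?thesis using CF by blast
    next
      case False
      \<comment> \<open>By compactness finite subfamilies suffice. A nonempty finite subchain
        contains its own intersection, which is a nonempty face; the empty one leaves
        \<open>C\<close>.\<close>
      have "C \<inter> \<Inter>c \<noteq> {}"
      proof (rule compact_imp_fip[OF C(1)])
        show "closed T" if "T \<in> c" for T using that c(1) by (auto simp: \<F>_def)
        fix d assume d: "finite d" "d \<subseteq> c"
        have "d \<noteq> {} \<longrightarrow> \<Inter>d \<in> d"
          using d
        proof (induction d rule: finite_induct)
          case (insert x d)
          show ?case
          proof (cases "d = {}")
            case False
            then have "\<Inter>d \<in> d" using insert by simp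
            then have "x \<subseteq> \<Inter>d \<or> \<Inter>d \<subseteq> x" using c(2) insert.prems by blast
            then show ?thesis
              using \<open>\<Inter>d \<in> d\<close> by (auto simp: Int_absorb1 Int_absorb2)
          qed simp
        qed simp
        then show "C \<inter> \<Inter>d \<noteq> {}"
          using c(1) d(2) C(4) face_of_imp_subset[of "\<Inter>d" C]
          by (cases "d = {}") (auto simp: \<F>_def Int_absorb1)
      qed
      moreover have "\<Inter>c face_of C"
        using False c(1) by (intro face_of_Inter) (auto simp: \<F>_def)
      moreover have "closed (\<Inter>c)"
        using c(1) by (auto simp: \<F>_def)
      ultimately have "\<Inter>c \<in> \<F>" by (auto simp: \<F>_def)
      then show ?thesis by blast
    qed
  qed
  then obtain M where M: "M face_of C" "closed M" "M \<noteq> {}"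
    and min: "\<And>F. F \<in> \<F> \<Longrightarrow> F \<subseteq> M \<Longrightarrow> F = M"
    by (auto simp: \<F>_def)
  have cM: "compact M" "convex M"
    using M(1,2) C(1) face_of_imp_subset[OF M(1)] face_of_imp_convex compact_Int_closed[of C M]
    by (simp_all add: Int_absorb1)
  have const: "l x = l y" if "l \<in> L" "x \<in> M" "y \<in> M" for l x y
  proof -
    have "continuous_on M l" using L(2)[OF that(1)] by (rule continuous_on_subset) simp
    then obtain z where z: "z \<in> M" "\<And>v. v \<in> M \<Longrightarrow> l v \<le> l z"
      using continuous_attains_sup[OF cM(1) M(3)] by blast
    \<comment> \<open>The set where \<open>l\<close> attains its maximum on \<open>M\<close> is
      again a nonempty closed face of \<open>C\<close>, so by minimality it is all of
      \<open>M\<close>.\<close>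
    have "{v\<in>M. l v = l z} face_of C"
      using face_of_linear_max[OF cM(2) L(1)[OF that(1)] z(2)] M(1) by (rule face_of_trans)
    moreover have "closed {v\<in>M. l v = l z}"
    proof -
      have "closed {v. l v = l z}"
        by (intro closed_Collect_eq L(2) that continuous_on_const)
      then have "closed (M \<inter> {v. l v = l z})" using M(2) by blast
      then show ?thesis by (simp add: Collect_conj_eq)
    qed
    ultimately have "{v\<in>M. l v = l z} \<in> \<F>" using z(1) by (auto simp: \<F>_def)
    from min[OF this] have "l v = l z" if "v \<in> M" for v using that by blast
    with that show ?thesis by simp
  qed
  obtain e where e: "e \<in> M" using M(3) by blast
  have "M = {e}" using const sep e by blast
  then show ?thesis using M(1) face_of_singleton by blast
qed

text \<open>The image is compact and convex in a Euclidean space, so Minkowski's theorem gives the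
  hull itself and not only its closure. Each extreme point of the image lifts to an extreme point of
  its fibre.\<close>

lemma linear_image_subset_hull_extreme_points:
  fixes C :: "'v::{real_vector,topological_space} set" and q :: "'v \<Rightarrow> 'w::euclidean_space"
  assumes C: "compact C" "closed C" "convex C"
    and L: "\<And>l. l \<in> L \<Longrightarrow> linear l" "\<And>l. l \<in> L \<Longrightarrow> continuous_on UNIV (l :: 'v \<Rightarrow> real)"
    and sep: "\<And>x y. (\<And>l. l \<in> L \<Longrightarrow> l x = l y) \<Longrightarrow> x = y"
    and q: "linear q" "continuous_on UNIV q"
  shows "q ` C \<subseteq> convex hull (q ` {e. e extreme_point_of C})"
proof -
  have "compact (q ` C)" "convex (q ` C)"
    using C q by (auto intro: compact_continuous_image continuous_on_subset convex_linear_image)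
  then have "q ` C = convex hull {p. p extreme_point_of (q ` C)}"
    by (rule Krein_Milman_Minkowski)
  also have "\<dots> \<subseteq> convex hull (q ` {e. e extreme_point_of C})"
  proof (intro hull_mono subsetI, clarify)
    fix p assume p: "p extreme_point_of (q ` C)"
    define F where "F = {v\<in>C. q v = p}"
    have face: "F face_of C"
      unfolding F_def using C(3) q(1) p by (rule face_of_linear_preimage_extreme_point)
    have "F \<noteq> {}" using p by (auto simp: F_def extreme_point_of_def)
    moreover have "compact F" "closed F"
    proof -
      have F: "F = C \<inter> {v. q v = p}" by (auto simp: F_def)
      have "closed {v. q v = p}"
        by (intro closed_Collect_eq q continuous_on_const)
      then show "compact F" "closed F"
        unfolding F using C(1,2) by (auto intro: compact_Int_closed)
    qed
    moreover have "convex F" using face by (rule face_of_imp_convex)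
    ultimately obtain e where "e extreme_point_of F"
      using extreme_point_exists[of F L] L sep by blast
    then have "e extreme_point_of C" "q e = p"
      using extreme_point_of_face[OF face] by (auto simp: F_def)
    then show "p \<in> q ` {e. e extreme_point_of C}" by blast
  qed
  finally show ?thesis .
qed

section \<open>Norming functionals\<close>

definition sublinear :: "('v::real_vector \<Rightarrow> real) \<Rightarrow> bool" where
  "sublinear p \<longleftrightarrow> (\<forall>x y. p (x + y) \<le> p x + p y) \<and> (\<forall>t>0. \<forall>x. p (t *\<^sub>R x) \<le> t * p x)"

lemma sublinear_zero: "sublinear p \<Longrightarrow> p 0 = 0"
proof -
  assume p: "sublinear p"
  then have "p (0 + 0) \<le> p 0 + p 0" unfolding sublinear_def by blast
  moreover have "p ((1/2) *\<^sub>R 0) \<le> 1/2 * p 0"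
    using p unfolding sublinear_def by (meson half_gt_zero zero_less_one)
  ultimately show ?thesis by simp
qed

text \<open>The inequality for \<open>inverse t\<close>, applied at \<open>t *\<^sub>R x\<close>,
  gives the reverse one. Requiring only an inequality in \<open>sublinear\<close> makes it easier to
  verify for infima.\<close>

lemma sublinear_scaleR:
  assumes p: "sublinear p" and t: "t > 0"
  shows "p (t *\<^sub>R x) = t * p x"
proof (rule antisym)
  show "p (t *\<^sub>R x) \<le> t * p x"
    using assms by (simp add: sublinear_def)
  have "p (inverse t *\<^sub>R (t *\<^sub>R x)) \<le> inverse t * p (t *\<^sub>R x)"
    using p t unfolding sublinear_def by (metis positive_imp_inverse_positive)
  then show "t * p x \<le> p (t *\<^sub>R x)"
    using t by (simp add: field_simps)
qed

lemma sublinear_minus_le: "sublinear p \<Longrightarrow> - p (- x) \<le> p x"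
proof -
  assume p: "sublinear p"
  then have "p (x + - x) \<le> p x + p (- x)" unfolding sublinear_def by blast
  then show ?thesis using sublinear_zero[OF p] by simp
qed

text \<open>This functional is below \<open>p\<close> and has value at most \<open>- p v\<close> at \<open>- v\<close>; so \<open>p (- v) = - p v\<close>
  for all \<open>v\<close> if \<open>p\<close> is minimal.\<close>

definition sublinear_descent :: "('v::real_vector \<Rightarrow> real) \<Rightarrow> 'v \<Rightarrow> 'v \<Rightarrow> real" where
  "sublinear_descent p v x = (INF t\<in>{0..}. p (x + t *\<^sub>R v) - t * p v)"

lemma sublinear_descent_le:
  assumes p: "sublinear p" and t: "t \<ge> 0"
  shows "sublinear_descent p v x \<le> p (x + t *\<^sub>R v) - t * p v"
  unfolding sublinear_descent_def
proof (rule cINF_lower)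
  show "bdd_below ((\<lambda>t. p (x + t *\<^sub>R v) - t * p v) ` {0..})"
  proof (rule bdd_belowI2)
    fix t :: real assume "t \<in> {0..}"
    then have "t * p v = p (t *\<^sub>R v)"
      using sublinear_scaleR[OF p, of t v] sublinear_zero[OF p] by (cases "t = 0") auto
    also have "\<dots> = p ((x + t *\<^sub>R v) + - x)" by simp
    also have "\<dots> \<le> p (x + t *\<^sub>R v) + p (- x)" using p unfolding sublinear_def by blast
    finally show "- p (- x) \<le> p (x + t *\<^sub>R v) - t * p v" by simp
  qed
qed (use t in auto)

lemma sublinear_descent_greatest:
  assumes "\<And>t. t \<ge> 0 \<Longrightarrow> m \<le> p (x + t *\<^sub>R v) - t * p v"
  shows "m \<le> sublinear_descent p v x"
  unfolding sublinear_descent_def by (rule cINF_greatest) (use assms in auto)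

lemma sublinear_sublinear_descent:
  assumes p: "sublinear p"
  shows "sublinear (sublinear_descent p v)"
  unfolding sublinear_def
proof (intro conjI allI impI)
  fix x y
  let ?q = "sublinear_descent p v"
  have *: "?q (x + y) - (p (x + s *\<^sub>R v) - s * p v) \<le> ?q y" if s: "s \<ge> 0" for s
  proof (rule sublinear_descent_greatest)
    fix t :: real assume t: "t \<ge> 0"
    \<comment> \<open>The shifts \<open>s\<close> for \<open>x\<close> and \<open>t\<close> for
      \<open>y\<close> combine to the shift \<open>s + t\<close> for \<open>x + y\<close>.\<close>
    have "?q (x + y) \<le> p ((x + y) + (s + t) *\<^sub>R v) - (s + t) * p v"
      using s t by (intro sublinear_descent_le p) simp
    also have "(x + y) + (s + t) *\<^sub>R v = (x + s *\<^sub>R v) + (y + t *\<^sub>R v)"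
      by (simp add: algebra_simps)
    also have "p ((x + s *\<^sub>R v) + (y + t *\<^sub>R v)) \<le> p (x + s *\<^sub>R v) + p (y + t *\<^sub>R v)"
      using p unfolding sublinear_def by blast
    finally show "?q (x + y) - (p (x + s *\<^sub>R v) - s * p v) \<le> p (y + t *\<^sub>R v) - t * p v"
      by (simp add: algebra_simps)
  qed
  then have "?q (x + y) - ?q y \<le> p (x + s *\<^sub>R v) - s * p v" if "s \<ge> 0" for s
    using *[OF that] by linarith
  then have "?q (x + y) - ?q y \<le> ?q x" by (rule sublinear_descent_greatest)
  then show "?q (x + y) \<le> ?q x + ?q y" by simp
next
  fix s :: real and x assume s: "s > 0"
  let ?q = "sublinear_descent p v"
  have "?q (s *\<^sub>R x) / s \<le> ?q x"
  proof (rule sublinear_descent_greatest)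
    fix t :: real assume t: "t \<ge> 0"
    have "?q (s *\<^sub>R x) \<le> p (s *\<^sub>R x + (s * t) *\<^sub>R v) - (s * t) * p v"
      using s t by (intro sublinear_descent_le p) simp
    also have "p (s *\<^sub>R x + (s * t) *\<^sub>R v) = s * p (x + t *\<^sub>R v)"
      using sublinear_scaleR[OF p s, of "x + t *\<^sub>R v"] by (simp add: algebra_simps)
    finally show "?q (s *\<^sub>R x) / s \<le> p (x + t *\<^sub>R v) - t * p v"
      using s by (simp add: field_simps)
  qed
  then show "?q (s *\<^sub>R x) \<le> s * ?q x" using s by (simp add: field_simps)
qed

text \<open>Minimality makes \<open>p\<close> odd. Subadditivity at \<open>x\<close>,
  \<open>y\<close> and at \<open>- x\<close>, \<open>- y\<close> then gives both inequalities of
  additivity.\<close>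

lemma minimal_sublinear_linear:
  assumes p: "sublinear p" and min: "\<And>q. sublinear q \<Longrightarrow> (\<And>x. q x \<le> p x) \<Longrightarrow> q = p"
  shows "linear p"
proof -
  have minus: "p (- v) = - p v" for v
  proof (rule antisym)
    have "sublinear_descent p v = p"
      using sublinear_descent_le[OF p, of 0 v]
      by (intro min sublinear_sublinear_descent p) simp
    then show "p (- v) \<le> - p v"
      using sublinear_descent_le[OF p, of 1 v "- v"] sublinear_zero[OF p] by simp
    show "- p v \<le> p (- v)"
      using sublinear_minus_le[OF p, of "- v"] by simp
  qed
  show ?thesis
  proof (rule linearI)
    fix x y
    have le: "p (a + b) \<le> p a + p b" for a b using p by (simp add: sublinear_def)
    show "p (x + y) = p x + p y"
      using le[of x y] le[of "- x" "- y"] minus[of "x + y"] by (simp add: minus)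
  next
    fix r :: real and x
    consider "r = 0" | "r > 0" | "- r > 0" by linarith
    then show "p (r *\<^sub>R x) = r *\<^sub>R p x"
    proof cases
      case 3
      then show ?thesis
        using sublinear_scaleR[OF p 3, of x] minus[of "r *\<^sub>R x"] by simp
    qed (simp_all add: sublinear_zero[OF p] sublinear_scaleR[OF p])
  qed
qed

text \<open>Zorn's lemma gives a minimal sublinear functional below \<open>p\<close>, which is
  linear. A chain is bounded below by its pointwise infimum, finite because every member is at least
  \<open>- p (- x)\<close> at \<open>x\<close>.\<close>

lemma ex_linear_le_sublinear:
  fixes p :: "'v::real_vector \<Rightarrow> real"
  assumes p: "sublinear p"
  shows "\<exists>f. linear f \<and> (\<forall>x. f x \<le> p x)"
proof -
  define \<S> where "\<S> = {q. sublinear q \<and> q \<le> p}"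
  have "\<exists>m\<in>\<S>. \<forall>q\<in>\<S>. m \<ge> q \<longrightarrow> q = m"
  proof (rule predicate_Zorn)
    show "partial_order_on \<S> (relation_of (\<lambda>a b. a \<ge> b) \<S>)"
      by (rule partial_order_on_relation_ofI) (rule order_refl, erule (1) order_trans, erule (1) antisym)
    fix c assume "c \<in> Chains (relation_of (\<lambda>a b. a \<ge> b) \<S>)"
    then have c: "c \<subseteq> \<S>" "\<And>a b. a \<in> c \<Longrightarrow> b \<in> c \<Longrightarrow> a \<le> b \<or> b \<le> a"
      by (auto simp: Chains_def relation_of_def)
    show "\<exists>u\<in>\<S>. \<forall>a\<in>c. a \<ge> u"
    proof (cases "c = {}")
      case True
      then show ?thesis using p by (auto simp: \<S>_def)
    next
      case False
      define u where "u x = (INF q\<in>c. q x)" for x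
      have lower: "u x \<le> q x" if q: "q \<in> c" for q x
        unfolding u_def
      proof (rule cINF_lower[OF _ q], rule bdd_belowI2)
        fix r assume "r \<in> c"
        then have "sublinear r" "r (- x) \<le> p (- x)" using c(1) by (auto simp: \<S>_def le_fun_def)
        then show "- p (- x) \<le> r x" using sublinear_minus_le[of r x] by linarith
      qed
      have greatest: "m \<le> u x" if "\<And>q. q \<in> c \<Longrightarrow> m \<le> q x" for m x
        unfolding u_def by (rule cINF_greatest) (use that False in auto)
      have sub: "sublinear q" if "q \<in> c" for q using that c(1) by (auto simp: \<S>_def)
      have "sublinear u"
        unfolding sublinear_def
      proof (intro conjI allI impI)
        fix x y
        have "u (x + y) \<le> q x + r y" if qr: "q \<in> c" "r \<in> c" for q r
        proof -
          \<comment> \<open>Subadditivity of an infimum needs a common lower bound of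
            \<open>q\<close> and \<open>r\<close> inside \<open>c\<close>; the chain property
            supplies it.\<close>
          obtain s where s: "s \<in> c" "s \<le> q" "s \<le> r" using c(2)[OF qr] qr by blast
          have "u (x + y) \<le> s (x + y)" by (rule lower[OF s(1)])
          also have "\<dots> \<le> s x + s y" using sub[OF s(1)] by (simp add: sublinear_def)
          also have "\<dots> \<le> q x + r y" using s(2,3) by (simp add: le_funD add_mono)
          finally show ?thesis .
        qed
        then have "u (x + y) - q x \<le> r y" if "q \<in> c" "r \<in> c" for q r
          using that by (simp add: diff_le_eq add.commute)
        then have "u (x + y) - q x \<le> u y" if "q \<in> c" for q
          using that by (intro greatest)
        then have "u (x + y) - u y \<le> q x" if "q \<in> c" for q
          using that by (simp add: diff_le_eq add.commute)
        then have "u (x + y) - u y \<le> u x"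
          by (intro greatest)
        then show "u (x + y) \<le> u x + u y" by simp
      next
        fix t :: real and x assume t: "t > 0"
        have "u (t *\<^sub>R x) / t \<le> u x"
        proof (rule greatest)
          fix q assume q: "q \<in> c"
          have "u (t *\<^sub>R x) \<le> t * q x"
            using lower[OF q, of "t *\<^sub>R x"] sublinear_scaleR[OF sub[OF q] t, of x] by simp
          then show "u (t *\<^sub>R x) / t \<le> q x" using t by (simp add: field_simps)
        qed
        then show "u (t *\<^sub>R x) \<le> t * u x" using t by (simp add: field_simps)
      qed
      moreover have "u \<le> p"
      proof (rule le_funI)
        fix x
        obtain q where q: "q \<in> c" using False by blast
        then have "q x \<le> p x" using c(1) by (auto simp: \<S>_def le_fun_def)
        with lower[OF q] show "u x \<le> p x" by (rule order_trans)
      qed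
      ultimately have "u \<in> \<S>" by (simp add: \<S>_def)
      moreover have "u \<le> q" if "q \<in> c" for q using lower[OF that] by (rule le_funI)
      ultimately show ?thesis by blast
    qed
  qed
  then obtain m where "m \<in> \<S>" and min: "\<And>q. q \<in> \<S> \<Longrightarrow> q \<le> m \<Longrightarrow> q = m"
    by blast
  then have m: "sublinear m" "m \<le> p" by (simp_all add: \<S>_def)
  have "linear m"
  proof (rule minimal_sublinear_linear[OF m(1)])
    fix q assume q: "sublinear q" "\<And>x. q x \<le> m x"
    then have "q \<le> m" by (simp add: le_fun_def)
    then show "q = m" using q(1) m(2) by (intro min) (simp_all add: \<S>_def)
  qed
  then show ?thesis using m by (auto simp: le_fun_def)
qed

text \<open>Domination by the descent of the norm, instead of the norm itself, forces the value at
  \<open>- v\<close> to be at most \<open>- norm v\<close>.\<close>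

lemma ex_real_norming_functional:
  fixes v :: "'v::real_normed_vector"
  obtains g :: "'v \<Rightarrow> real" where "linear g" "\<And>x. g x \<le> norm x" "g v = norm v"
proof -
  have n: "sublinear (norm :: 'v \<Rightarrow> real)"
    by (simp add: sublinear_def norm_triangle_ineq)
  obtain g where g: "linear g" "\<And>x. g x \<le> sublinear_descent norm v x"
    using ex_linear_le_sublinear[OF sublinear_sublinear_descent[OF n]] by blast
  have le: "g x \<le> norm x" for x
    using g(2)[of x] sublinear_descent_le[OF n, of 0 v x] by simp
  have "g (- v) \<le> - norm v"
    using g(2)[of "- v"] sublinear_descent_le[OF n, of 1 v "- v"] by simp
  then have "g v = norm v"
    using le[of v] by (simp add: linear_neg[OF g(1)])
  with g(1) le that show ?thesis by blast
qed

lemma eq_if_re_mult_eq: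
  fixes w w' :: "'k::real_or_complex"
  assumes "\<And>c. re (c * w) = re (c * w')"
  shows "w = w'"
proof -
  obtain c where "c * (w - w') = of_real (norm (w - w'))" by (rule ex_rotation)
  then have "norm (w - w') = re (c * w - c * w')" by (simp add: right_diff_distrib)
  then show ?thesis by (simp add: assms)
qed

text \<open>For each \<open>y\<close> the map sending \<open>c\<close> to
  \<open>g (scale c y)\<close> is real-linear, hence equals \<open>re (c * F y)\<close> for a unique
  \<open>F y\<close>. Uniqueness makes \<open>F\<close> linear over the scalars, and a rotation
  transfers the bound from \<open>g\<close> to \<open>F\<close>.\<close>

lemma (in banach_over) ex_norming_functional:
  obtains f where "f \<in> dual_ball scale" "blinfun_apply f v = of_real (norm v)"
proof -
  obtain g where g: "linear g" "\<And>x. g x \<le> norm x" "g v = norm v"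
    using ex_real_norming_functional[of v] by blast
  have "linear (\<lambda>c. g (scale c y))" for y
  proof (rule linearI)
    fix r c
    have "scale (r *\<^sub>R c) y = r *\<^sub>R scale c y"
      by (metis scale_of_real scale_scale scaleR_conv_of_real)
    then show "g (scale (r *\<^sub>R c) y) = r *\<^sub>R g (scale c y)"
      by (simp add: linear_scale[OF g(1)])
  qed (simp add: scale_left_distrib linear_add[OF g(1)])
  then have "\<exists>w. \<forall>c. g (scale c y) = re (c * w)" for y
    by (metis linear_functional_re_mult)
  then obtain F where F: "\<And>c y. g (scale c y) = re (c * F y)" by metis
  have add: "F (x + y) = F x + F y" for x y
    by (rule eq_if_re_mult_eq)
      (simp add: scale_right_distrib linear_add[OF g(1)] distrib_left flip: F)
  have hom: "F (scale d y) = d * F y" for d y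
    by (rule eq_if_re_mult_eq) (metis F mult.assoc scale_scale)
  have norm_le: "norm (F y) \<le> norm y" for y
  proof -
    obtain c where c: "norm c = 1" "c * F y = of_real (norm (F y))" by (rule ex_rotation)
    have "norm (F y) = g (scale c y)" by (simp add: F c)
    also have "\<dots> \<le> norm y" using g(2)[of "scale c y"] c by (simp add: norm_scale)
    finally show ?thesis .
  qed
  have "bounded_linear F"
  proof (rule bounded_linear_intro[where K = 1])
    show "F (r *\<^sub>R x) = r *\<^sub>R F x" for r x
      using hom[of "of_real r" x] by (simp add: scale_of_real scaleR_conv_of_real)
  qed (use add norm_le in auto)
  then have ap: "blinfun_apply (Blinfun F) = F" by (rule bounded_linear_Blinfun_apply)
  have "norm (Blinfun F) \<le> 1"
    by (rule norm_blinfun_bound) (simp_all add: ap norm_le)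
  then have "Blinfun F \<in> dual_ball scale"
    by (simp add: dual_ball_def dual_def bounded_ops_def ap hom)
  moreover have "F v = of_real (norm v)"
  proof (rule eq_of_real_if_re_ge_norm)
    show "norm v \<le> re (F v)" using F[of 1 v] g(3) by simp
  qed (rule norm_le)
  ultimately show ?thesis using that ap by metis
qed

section \<open>Weak* compactness of the dual balls\<close>

lemma closed_Pi_cball:
  "closed {\<phi> :: 'i \<Rightarrow> 'k::real_normed_vector. \<forall>i. norm (\<phi> i) \<le> r i}"
  by (intro closed_Collect_all closed_Collect_le continuous_intros continuous_on_product_coordinates)

text \<open>Tychonoff's theorem. Function types carry the topology of pointwise convergence, which
  plays the part of the weak* topology.\<close>

lemma compact_Pi_cball:
  "compact {\<phi> :: 'i \<Rightarrow> 'k::real_or_complex. \<forall>i. norm (\<phi> i) \<le> r i}"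
proof -
  have "compactin (product_topology (\<lambda>i. euclidean) UNIV) (PiE UNIV (\<lambda>i. cball (0::'k) (r i)))"
    by (subst compactin_PiE) (simp add: compact_cball_scalar)
  moreover have "PiE UNIV (\<lambda>i. cball (0::'k) (r i)) = {\<phi>. \<forall>i. norm (\<phi> i) \<le> r i}"
    by auto
  ultimately show ?thesis
    by (simp add: euclidean_product_topology)
qed

text \<open>The operator type carries the norm topology, so weak* statements are made about the
  underlying functions. The right-hand side consists of conditions that are closed under pointwise
  limits.\<close>

lemma (in banach_over) image_dual_ball_eq:
  "blinfun_apply ` dual_ball scale =
     {g. (\<forall>x y. g (x + y) = g x + g y) \<and> (\<forall>c x. g (scale c x) = c * g x) \<and> (\<forall>x. norm (g x) \<le> norm x)}"
  (is "_ = ?R")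
proof (intro equalityI subsetI)
  fix g assume "g \<in> blinfun_apply ` dual_ball scale"
  then obtain f where f: "g = blinfun_apply f" "f \<in> dual scale" "norm f \<le> 1"
    by (auto simp: dual_ball_def)
  have "norm (g x) \<le> norm x" for x
    using norm_blinfun[of f x] mult_right_mono[OF f(3), of "norm x"] f(1) by simp
  then show "g \<in> ?R"
    using f(1,2) by (simp add: blinfun.add_right dual_def bounded_ops_def)
next
  fix g assume g: "g \<in> ?R"
  have "bounded_linear g"
  proof (rule bounded_linear_intro[where K = 1])
    show "g (r *\<^sub>R x) = r *\<^sub>R g x" for r x
      using g by (simp add: scaleR_conv_of_real flip: scale_of_real)
  qed (use g in auto)
  then have ap: "blinfun_apply (Blinfun g) = g" by (rule bounded_linear_Blinfun_apply)
  have "norm (Blinfun g) \<le> 1"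
    by (rule norm_blinfun_bound) (use g in \<open>simp_all add: ap\<close>)
  then have "Blinfun g \<in> dual_ball scale"
    using g by (simp add: dual_ball_def dual_def bounded_ops_def ap)
  then show "g \<in> blinfun_apply ` dual_ball scale"
    using ap by (metis image_eqI)
qed

lemma (in banach_over) compact_closed_image_dual_ball:
  "compact (blinfun_apply ` dual_ball scale)" "closed (blinfun_apply ` dual_ball scale)"
proof -
  have "closed {g. (\<forall>x y. g (x + y) = g x + g y) \<and> (\<forall>c x. g (scale c x) = c * g x)}"
    by (intro closed_Collect_conj closed_Collect_all closed_Collect_eq continuous_intros
        continuous_on_product_coordinates)
  moreover have "blinfun_apply ` dual_ball scale = {g. \<forall>x. norm (g x) \<le> norm x} \<inter>
      {g. (\<forall>x y. g (x + y) = g x + g y) \<and> (\<forall>c x. g (scale c x) = c * g x)}"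
    unfolding image_dual_ball_eq by blast
  ultimately show "compact (blinfun_apply ` dual_ball scale)" "closed (blinfun_apply ` dual_ball scale)"
    by (simp_all add: compact_Int_closed compact_Pi_cball closed_Pi_cball closed_Int)
qed

lemma (in banach_over) compact_closed_bidual_ball:
  "compact (bidual_ball scale)" "closed (bidual_ball scale)"
proof -
  let ?D = "dual scale"
  \<comment> \<open>Radius 0 off the dual encodes the default value there, and the bound by
    \<open>norm f\<close> on the dual gives boundedness with constant 1. What remains is
    closed.\<close>
  have eq: "bidual_ball scale =
    {\<phi>. \<forall>f. norm (\<phi> f) \<le> (if f \<in> ?D then norm f else 0)} \<inter>
    {\<phi>. (\<forall>f\<in>?D. \<forall>g\<in>?D. \<phi> (f + g) = \<phi> f + \<phi> g) \<and> (\<forall>c. \<forall>f\<in>?D. \<phi> (op_scale (*) c f) = c * \<phi> f)}"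
    (is "_ = ?A \<inter> ?B")
  proof (intro equalityI subsetI)
    fix \<phi> assume \<phi>: "\<phi> \<in> ?A \<inter> ?B"
    then have le: "norm (\<phi> f) \<le> (if f \<in> ?D then norm f else 0)" for f by blast
    then have "\<forall>f\<in>?D. norm (\<phi> f) \<le> norm f" by (metis (full_types))
    moreover have "\<forall>f. f \<notin> ?D \<longrightarrow> \<phi> f = 0"
      using le by (metis norm_le_zero_iff)
    moreover have "\<exists>B. \<forall>f\<in>?D. norm (\<phi> f) \<le> B * norm f"
      using calculation(1) by (intro exI[of _ 1]) simp
    ultimately show "\<phi> \<in> bidual_ball scale"
      using \<phi> unfolding bidual_ball_iff bidual_def by simp
  qed (auto simp: bidual_ball_iff bidual_def)
  have "closed ?B"
    unfolding Ball_def
    by (intro closed_Collect_conj closed_Collect_all closed_Collect_imp closed_Collect_eq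
        continuous_intros continuous_on_product_coordinates) simp_all
  then show "compact (bidual_ball scale)" "closed (bidual_ball scale)"
    unfolding eq by (rule compact_Int_closed[OF compact_Pi_cball], rule closed_Int[OF closed_Pi_cball])
qed

section \<open>Convexity of the unit balls\<close>

lemma (in banach_over) convex_dual_ball: "convex (dual_ball scale)"
  unfolding convex_def
proof (intro ballI allI impI)
  fix f g and u v :: real
  assume fg: "f \<in> dual_ball scale" "g \<in> dual_ball scale" and uv: "0 \<le> u" "0 \<le> v" "u + v = 1"
  have "norm (u *\<^sub>R f + v *\<^sub>R g) \<le> u * norm f + v * norm g"
    using uv norm_triangle_ineq[of "u *\<^sub>R f" "v *\<^sub>R g"] by simp
  also have "\<dots> \<le> 1"
    using fg uv by (intro convex_bound_le) (auto simp: dual_ball_def)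
  finally show "u *\<^sub>R f + v *\<^sub>R g \<in> dual_ball scale"
    using fg by (simp add: dual_ball_def dual_def bounded_ops_def blinfun.add_left
        blinfun.scaleR_left algebra_simps)
qed

lemma (in banach_over) convex_bidual_ball: "convex (bidual_ball scale)"
  unfolding convex_def
proof (intro ballI allI impI)
  fix \<phi> \<psi> and u v :: real
  assume ab: "\<phi> \<in> bidual_ball scale" "\<psi> \<in> bidual_ball scale" and uv: "0 \<le> u" "0 \<le> v" "u + v = 1"
  have ap: "(u *\<^sub>R \<phi> + v *\<^sub>R \<psi>) f = u *\<^sub>R \<phi> f + v *\<^sub>R \<psi> f" for f
    by (simp add: scaleR_fun_def plus_fun_def)
  have le: "norm (u *\<^sub>R \<phi> f + v *\<^sub>R \<psi> f) \<le> norm f" if "f \<in> dual scale" for f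
  proof -
    have "norm (u *\<^sub>R \<phi> f + v *\<^sub>R \<psi> f) \<le> u * norm (\<phi> f) + v * norm (\<psi> f)"
      using uv norm_triangle_ineq[of "u *\<^sub>R \<phi> f" "v *\<^sub>R \<psi> f"] by simp
    also have "\<dots> \<le> norm f"
      using ab uv that by (intro convex_bound_le) (auto simp: bidual_ball_iff)
    finally show ?thesis .
  qed
  then have "\<exists>B. \<forall>f\<in>dual scale. norm (u *\<^sub>R \<phi> f + v *\<^sub>R \<psi> f) \<le> B * norm f"
    by (intro exI[of _ 1]) simp
  then show "u *\<^sub>R \<phi> + v *\<^sub>R \<psi> \<in> bidual_ball scale"
    using ab le unfolding bidual_ball_iff bidual_def ap mem_Collect_eq
    by (simp add: algebra_simps)
qed

section \<open>Evaluations on faces\<close>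

lemma linear_evaluation: "linear (\<lambda>\<phi> :: 'i \<Rightarrow> 'k::real_vector. \<phi> i)"
  by (rule linearI) (simp_all add: plus_fun_def scaleR_fun_def)

text \<open>The real parts of scalar multiples of coordinates are continuous and separate points.
  Composing the evaluation with \<open>cembed\<close> gives it a Euclidean target.\<close>

lemma evaluation_mem_hull_extreme_points:
  fixes C :: "('i \<Rightarrow> 'k::real_or_complex) set"
  assumes "compact C" "closed C" "convex C" "\<phi> \<in> C"
  shows "\<phi> i \<in> convex hull {e i |e. e extreme_point_of C}"
proof -
  define L where "L = {\<lambda>\<psi> :: 'i \<Rightarrow> 'k. re (c * \<psi> k) |c k. True}"
  have lin: "linear l" if "l \<in> L" for l
    using that by (auto simp: L_def plus_fun_def scaleR_fun_def algebra_simps intro!: linearI)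
  have cont: "continuous_on UNIV l" if "l \<in> L" for l
    using that by (auto simp: L_def intro!: continuous_intros continuous_on_product_coordinates)
  have sep: "x = y" if "\<And>l. l \<in> L \<Longrightarrow> l x = l y" for x y
  proof (rule ext, rule eq_if_re_mult_eq)
    fix k c
    have "(\<lambda>\<psi>. re (c * \<psi> k)) \<in> L" by (auto simp: L_def)
    from that[OF this] show "re (c * x k) = re (c * y k)" .
  qed
  let ?q = "\<lambda>\<psi> :: 'i \<Rightarrow> 'k. cembed (\<psi> i)"
  have "?q ` C \<subseteq> convex hull (?q ` {e. e extreme_point_of C})"
  proof (rule linear_image_subset_hull_extreme_points[of _ L, OF assms(1-3) lin cont sep])
    show "linear ?q"
      using linear_compose[OF linear_evaluation linear_cembed, of i] by (simp add: o_def)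
    show "continuous_on UNIV ?q"
      by (intro continuous_intros continuous_on_product_coordinates)
  qed
  also have "?q ` {e. e extreme_point_of C} = cembed ` {e i |e. e extreme_point_of C}"
    by auto
  also have "convex hull \<dots> = cembed ` (convex hull {e i |e. e extreme_point_of C})"
    by (rule convex_hull_linear_image[OF linear_cembed, symmetric])
  finally have "cembed (\<phi> i) \<in> cembed ` (convex hull {e i |e. e extreme_point_of C})"
    using assms(4) by blast
  then show ?thesis by (simp only: inj_image_mem_iff[OF inj_cembed])
qed

text \<open>The members of \<open>C\<close> with value \<open>m\<close> at \<open>k\<close> form a
  closed face, and the extreme points of a face are the extreme points of \<open>C\<close> lying in
  it.\<close>

lemma evaluation_mem_hull_extreme_points_face:
  fixes C :: "('i \<Rightarrow> 'k::real_or_complex) set"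
  assumes C: "compact C" "closed C" "convex C" and m: "\<And>\<psi>. \<psi> \<in> C \<Longrightarrow> norm (\<psi> k) \<le> m"
    and \<phi>: "\<phi> \<in> C" "\<phi> k = of_real m"
  shows "\<phi> i \<in> convex hull {e i |e. e extreme_point_of C \<and> e k = of_real m}"
proof -
  define F where "F = {\<psi>\<in>C. re (\<psi> k) = m}"
  have F: "F = {\<psi>\<in>C. \<psi> k = of_real m}"
    unfolding F_def using m eq_of_real_if_re_ge_norm[of _ m] by fastforce
  have face: "F face_of C"
    unfolding F_def
  proof (rule face_of_linear_max[OF C(3)])
    show "linear (\<lambda>\<psi> :: 'i \<Rightarrow> 'k. re (\<psi> k))"
      using linear_compose[OF linear_evaluation linear_re, of k] by (simp add: o_def)
    show "re (\<psi> k) \<le> m" if "\<psi> \<in> C" for \<psi>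
      using m[OF that] re_le_norm order_trans by blast
  qed
  have "closed {\<psi> :: 'i \<Rightarrow> 'k. re (\<psi> k) = m}"
    by (intro closed_Collect_eq continuous_intros continuous_on_product_coordinates)
  moreover have "F = C \<inter> {\<psi>. re (\<psi> k) = m}" by (auto simp: F_def)
  ultimately have "compact F" "closed F"
    using C(1,2) by (auto intro: compact_Int_closed)
  moreover have "convex F" using face by (rule face_of_imp_convex)
  moreover have "\<phi> \<in> F" using \<phi> by (simp add: F)
  ultimately have "\<phi> i \<in> convex hull {e i |e. e extreme_point_of F}"
    by (rule evaluation_mem_hull_extreme_points)
  also have "{e i |e. e extreme_point_of F} = {e i |e. e extreme_point_of C \<and> e k = of_real m}"
    unfolding extreme_point_of_face[OF face] by (auto simp: F extreme_point_of_def)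
  finally show ?thesis .
qed

lemma (in banach_over) bidual_evaluation_mem_hull:
  assumes "f \<in> dual scale" "\<phi> \<in> bidual_ball scale" "norm f \<le> m" "\<phi> f = of_real m"
  shows "\<phi> g \<in> convex hull {\<psi> g |\<psi>. \<psi> extreme_point_of (bidual_ball scale) \<and> \<psi> f = of_real m}"
  using assms
  by (intro evaluation_mem_hull_extreme_points_face compact_closed_bidual_ball convex_bidual_ball)
    (force simp: bidual_ball_iff)+

lemma (in banach_over) dual_evaluation_mem_hull:
  assumes f: "f \<in> dual_ball scale" and y: "norm y \<le> m" "blinfun_apply f y = of_real m"
  shows "blinfun_apply f z \<in> convex hull
    {blinfun_apply e z |e. e extreme_point_of (dual_ball scale) \<and> blinfun_apply e y = of_real m}"
proof -
  let ?P = "blinfun_apply ` dual_ball scale"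
  have lin: "linear (blinfun_apply :: _ \<Rightarrow> 'a \<Rightarrow> 'k)"
    by (rule linearI) (simp_all add: fun_eq_iff plus_fun_def scaleR_fun_def blinfun.add_left blinfun.scaleR_left)
  have inj: "inj (blinfun_apply :: _ \<Rightarrow> 'a \<Rightarrow> 'k)"
    by (simp add: inj_def blinfun_apply_inject)
  \<comment> \<open>An injective linear map preserves and reflects extreme points, so the result for
    functions carries over to operators.\<close>
  have ext: "e extreme_point_of ?P \<longleftrightarrow> e \<in> blinfun_apply ` {e. e extreme_point_of dual_ball scale}" for e
  proof -
    have "e extreme_point_of ?P \<Longrightarrow> e \<in> ?P" by (simp add: extreme_point_of_def)
    moreover have "blinfun_apply e extreme_point_of ?P \<longleftrightarrow> e extreme_point_of dual_ball scale" for e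
      using face_of_linear_image[OF lin inj, of "{e}" "dual_ball scale"]
      by (simp add: face_of_singleton)
    ultimately show ?thesis by blast
  qed
  have "blinfun_apply f z \<in> convex hull {e z |e. e extreme_point_of ?P \<and> e y = of_real m}"
  proof (rule evaluation_mem_hull_extreme_points_face[OF compact_closed_image_dual_ball])
    show "convex ?P" by (rule convex_linear_image[OF lin convex_dual_ball])
    show "norm (\<psi> y) \<le> m" if "\<psi> \<in> ?P" for \<psi>
      using that y(1) order_trans unfolding image_dual_ball_eq by blast
  qed (use f y in auto)
  also have "{e z |e. e extreme_point_of ?P \<and> e y = of_real m} =
    {blinfun_apply e z |e. e extreme_point_of (dual_ball scale) \<and> blinfun_apply e y = of_real m}"
    unfolding ext by blast
  finally show ?thesis .
qed

section \<open>The limit set of norming pairs\<close>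

lemma (in banach_over) norm_dual_ball_le:
  "f \<in> dual_ball scale \<Longrightarrow> norm (blinfun_apply f x) \<le> norm x"
  using norm_blinfun[of f x] mult_right_mono[of "norm f" 1 "norm x"]
  by (simp add: dual_ball_def)

text \<open>All functionals in the unit ball are 1-Lipschitz, so pointwise convergence of
  \<open>f\<close> and norm convergence of \<open>y\<close> together give convergence of
  \<open>f y\<close>.\<close>

lemma (in banach_over) continuous_on_evaluation_pair:
  "continuous_on ((blinfun_apply ` dual_ball scale) \<times> UNIV) (\<lambda>(f, y). f y)"
proof -
  let ?P = "(blinfun_apply ` dual_ball scale) \<times> (UNIV :: 'a set)"
  have "((\<lambda>p. fst p (snd p)) \<longlongrightarrow> f0 y0) (at (f0, y0) within ?P)"
    if f0: "(f0, y0) \<in> ?P" for f0 y0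
  proof -
    have snd: "(snd \<longlongrightarrow> y0) (at (f0, y0) within ?P)"
      using tendsto_snd[OF tendsto_ident_at, of "(f0, y0)"] by simp
    have "((\<lambda>p. fst p (snd p) - fst p y0) \<longlongrightarrow> 0) (at (f0, y0) within ?P)"
    proof (rule Lim_null_comparison)
      show "((\<lambda>p. norm (snd p - y0)) \<longlongrightarrow> 0) (at (f0, y0) within ?P)"
        by (rule tendsto_norm_zero[OF LIM_zero[OF snd]])
      show "\<forall>\<^sub>F p in at (f0, y0) within ?P. norm (fst p (snd p) - fst p y0) \<le> norm (snd p - y0)"
        unfolding eventually_at_topological
        by (intro exI[of _ UNIV]) (auto simp: norm_dual_ball_le simp flip: blinfun.diff_right)
    qed
    moreover have "((\<lambda>p. fst p y0) \<longlongrightarrow> f0 y0) (at (f0, y0) within ?P)"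
    proof -
      have "continuous_on UNIV (\<lambda>p :: ('a \<Rightarrow> 'k) \<times> 'a. fst p y0)"
        by (rule continuous_on_product_then_coordinatewise[OF continuous_on_fst[OF continuous_on_id]])
      then have "continuous_on ?P (\<lambda>p. fst p y0)" by (rule continuous_on_subset) simp
      then show ?thesis using f0 unfolding continuous_on_def by fastforce
    qed
    ultimately have "((\<lambda>p. (fst p (snd p) - fst p y0) + fst p y0) \<longlongrightarrow> 0 + f0 y0) (at (f0, y0) within ?P)"
      by (rule tendsto_add)
    then show ?thesis by simp
  qed
  then show ?thesis unfolding continuous_on_def case_prod_beta by auto
qed

lemma banach_adjoint_apply [simp]:
  "blinfun_apply (banach_adjoint T f) x = blinfun_apply f (blinfun_apply T x)"
  by (simp add: banach_adjoint_def)

lemma norm_banach_adjoint_le: "norm f \<le> 1 \<Longrightarrow> norm (banach_adjoint T f) \<le> norm T"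
  unfolding banach_adjoint_def
  using norm_blinfun_compose[of f T] mult_right_mono[of "norm f" 1 "norm T"] by simp

lemma banach_adjoint_add_op_scale:
  assumes "f \<in> dual scaleY" "banach_over scaleY"
  shows "banach_adjoint (T + op_scale scaleY c A) f =
    banach_adjoint T f + op_scale (*) c (banach_adjoint A f)"
proof (rule blinfun_eqI)
  interpret banach_over scaleY by fact
  show "blinfun_apply (banach_adjoint (T + op_scale scaleY c A) f) x =
      blinfun_apply (banach_adjoint T f + op_scale (*) c (banach_adjoint A f)) x" for x
    using assms(1) by (simp add: blinfun.add_left blinfun.add_right dual_def bounded_ops_def)
qed

text \<open>If \<open>y\<close> and \<open>z\<close> are limits of \<open>T x\<close> and \<open>A x\<close> along a net in the unit ball, then a weak*
  limit \<open>\<phi>\<close> of the same net satisfies the two equations below. So \<open>\<phi> \<circ> T\<^sup>*\<close> and \<open>\<phi> \<circ> A\<^sup>*\<close> are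
  evaluations, and the joint compactness needed for the passage to the limit is that of the
  images of the ball, without Schauder's theorem.\<close>

definition bidual_limits ::
  "('k::real_or_complex \<Rightarrow> 'x \<Rightarrow> 'x) \<Rightarrow> ('k \<Rightarrow> 'y \<Rightarrow> 'y) \<Rightarrow> ('x::banach \<Rightarrow>\<^sub>L 'y::banach) \<Rightarrow> ('x \<Rightarrow>\<^sub>L 'y)
    \<Rightarrow> ((('x \<Rightarrow>\<^sub>L 'k) \<Rightarrow> 'k) \<times> 'y \<times> 'y) set" where
  "bidual_limits sX sY T A =
    (bidual_ball sX \<times> closure (blinfun_apply T ` cball 0 1) \<times> closure (blinfun_apply A ` cball 0 1)) \<inter>
    {(\<phi>, y, z). \<forall>f\<in>dual sY. \<phi> (banach_adjoint T f) = blinfun_apply f y \<and>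
                            \<phi> (banach_adjoint A f) = blinfun_apply f z}"

text \<open>For fixed \<open>f\<close> each equation compares continuous functions of the triple, so
  the equations cut a closed set out of a product of compact sets.\<close>

lemma compact_bidual_limits:
  assumes "banach_over scaleX" "T \<in> compact_ops scaleX scaleY" "A \<in> compact_ops scaleX scaleY"
  shows "compact (bidual_limits scaleX scaleY T A)"
  unfolding bidual_limits_def
proof (rule compact_Int_closed)
  interpret banach_over scaleX by fact
  show "compact (bidual_ball scaleX \<times> closure (blinfun_apply T ` cball 0 1) \<times>
      closure (blinfun_apply A ` cball 0 1))"
    using assms(2,3) by (intro compact_Times compact_closed_bidual_ball) (simp_all add: compact_ops_def)
  have fst: "continuous_on UNIV (\<lambda>p. fst p g)" for g
    by (rule continuous_on_product_then_coordinatewise[OF continuous_on_fst[OF continuous_on_id]])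
  show "closed {(\<phi>, y, z). \<forall>f\<in>dual scaleY. \<phi> (banach_adjoint T f) = blinfun_apply f y \<and>
                            \<phi> (banach_adjoint A f) = blinfun_apply f z}"
    unfolding Ball_def case_prod_beta
    by (intro closed_Collect_all closed_Collect_imp closed_Collect_conj closed_Collect_eq fst
        continuous_intros) simp_all
qed

lemma (in banach_over) evaluation_in_bidual_ball:
  assumes "norm x \<le> 1"
  shows "(\<lambda>f. if f \<in> dual scale then blinfun_apply f x else 0) \<in> bidual_ball scale"
proof -
  have closed: "f + g \<in> dual scale" "op_scale (*) c f \<in> dual scale"
    if "f \<in> dual scale" "g \<in> dual scale" for f g and c :: 'k
    using that by (simp_all add: dual_def bounded_ops_def blinfun.add_left algebra_simps)
  have le: "norm (blinfun_apply f x) \<le> norm f" for f :: "'a \<Rightarrow>\<^sub>L 'k"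
    using norm_blinfun[of f x] mult_left_mono[OF assms, of "norm f"] by simp
  then have "\<exists>B. \<forall>f\<in>dual scale. norm (blinfun_apply f x) \<le> B * norm f"
    by (intro exI[of _ 1]) simp
  then show ?thesis
    using closed le by (simp add: bidual_ball_iff bidual_def blinfun.add_left)
qed

lemma ex_unit_ball_norm_ge:
  assumes "\<epsilon> > 0"
  obtains x where "norm x \<le> 1" "norm (blinfun_apply S x) \<ge> norm S - \<epsilon>"
proof -
  have "\<exists>x. norm x \<le> 1 \<and> norm (blinfun_apply S x) \<ge> norm S - \<epsilon>"
  proof (rule ccontr)
    assume "\<not> ?thesis"
    then have less: "norm (blinfun_apply S x) < norm S - \<epsilon>" if "norm x \<le> 1" for x
      using that by force
    have "norm S \<le> norm S - \<epsilon>"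
    proof (rule norm_blinfun_bound)
      show "0 \<le> norm S - \<epsilon>" using less[of 0] by simp
      fix x
      show "norm (blinfun_apply S x) \<le> (norm S - \<epsilon>) * norm x"
      proof (cases "x = 0")
        case False
        then have "norm (blinfun_apply S (x /\<^sub>R norm x)) < norm S - \<epsilon>" by (intro less) simp
        then show ?thesis using False by (simp add: blinfun.scaleR_right field_simps)
      qed simp
    qed
    with assms show False by simp
  qed
  with that show ?thesis by blast
qed

lemma closure_image_ball_le:
  assumes "y \<in> closure (blinfun_apply T ` cball 0 1)"
  shows "norm y \<le> norm T"
proof -
  have "norm (blinfun_apply T x) \<le> norm T" if "norm x \<le> 1" for x
    using norm_blinfun[of T x] mult_left_mono[OF that, of "norm T"] by simp
  then have "closure (blinfun_apply T ` cball 0 1) \<subseteq> cball 0 (norm T)"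
    by (intro closure_minimal) auto
  with assms show ?thesis by auto
qed

lemma zero_in_hull_limit_values:
  fixes scaleX :: "'k::real_or_complex \<Rightarrow> 'x::banach \<Rightarrow> 'x"
    and scaleY :: "'k \<Rightarrow> 'y::banach \<Rightarrow> 'y"
  assumes X: "banach_over scaleX" and Y: "banach_over scaleY"
    and T: "T \<in> compact_ops scaleX scaleY" and A: "A \<in> compact_ops scaleX scaleY"
    and orth: "birkhoff_orthogonal (op_scale scaleY) T A"
  shows "0 \<in> convex hull {blinfun_apply f z |\<phi> y z f. (\<phi>, y, z) \<in> bidual_limits scaleX scaleY T A \<and>
     f \<in> dual_ball scaleY \<and> blinfun_apply f y = of_real (norm T)}" (is "0 \<in> convex hull ?D")
proof (rule ccontr)
  assume not: "0 \<notin> convex hull ?D"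
  interpret X: banach_over scaleX by fact
  interpret Y: banach_over scaleY by fact
  define N where "N = bidual_limits scaleX scaleY T A"
  define P where "P = blinfun_apply ` dual_ball scaleY"
  \<comment> \<open>\<open>M\<close> collects the value pairs for \<open>T\<close> and
    \<open>A\<close> before the norming condition is imposed. It is compact, and \<open>?D\<close>
    is its slice with first coordinate \<open>norm T\<close>.\<close>
  define M where "M = (\<lambda>(n, f). (f (fst (snd n)), f (snd (snd n)))) ` (N \<times> P)"
  have ev: "continuous_on (N \<times> P) (\<lambda>p. snd p (h p))" if "continuous_on (N \<times> P) h" for h
  proof -
    have "continuous_on (N \<times> P) (\<lambda>p. (\<lambda>(f, y). f y) (snd p, h p))"
      by (rule continuous_on_compose2[OF Y.continuous_on_evaluation_pair
            continuous_on_Pair[OF continuous_on_snd[OF continuous_on_id] that]])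
        (auto simp: P_def)
    then show ?thesis by simp
  qed
  have "continuous_on (N \<times> P) (\<lambda>(n, f). (f (fst (snd n)), f (snd (snd n))))"
    unfolding case_prod_beta by (intro continuous_on_Pair ev continuous_on_fst continuous_on_snd continuous_on_id)
  then have cM: "compact M"
    unfolding M_def using compact_bidual_limits[OF X T A] Y.compact_closed_image_dual_ball(1)
    by (intro compact_continuous_image compact_Times) (simp_all add: N_def P_def)
  have D: "?D = snd ` (M \<inter> {p. fst p = of_real (norm T)})"
  proof (intro equalityI subsetI)
    fix d assume "d \<in> ?D"
    then obtain \<phi> y z f where "(\<phi>, y, z) \<in> N" "blinfun_apply f \<in> P"
      and f: "blinfun_apply f y = of_real (norm T)" and d: "d = blinfun_apply f z"
      unfolding N_def P_def by blast
    then have "(blinfun_apply f y, blinfun_apply f z) \<in> M"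
      unfolding M_def by (intro image_eqI[of _ _ "((\<phi>, y, z), blinfun_apply f)"]) auto
    then show "d \<in> snd ` (M \<inter> {p. fst p = of_real (norm T)})"
      unfolding d f by (intro image_eqI[of _ _ "(of_real (norm T), blinfun_apply f z)"]) auto
  next
    fix d assume "d \<in> snd ` (M \<inter> {p. fst p = of_real (norm T)})"
    then show "d \<in> ?D"
      unfolding M_def N_def P_def by fastforce
  qed
  have "closed {p :: 'k \<times> 'k. fst p = of_real (norm T)}"
    by (intro closed_Collect_eq continuous_intros)
  then have cD: "compact ?D"
    unfolding D using cM by (intro compact_continuous_image compact_Int_closed continuous_intros)
  have M_le: "norm a \<le> norm T" if "(a, b) \<in> M" for a b
  proof -
    from that obtain y f where "a = blinfun_apply f y" "f \<in> dual_ball scaleY"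
      and y: "y \<in> closure (blinfun_apply T ` cball 0 1)"
      by (auto simp: M_def N_def P_def bidual_limits_def)
    then have "norm a \<le> norm y" by (simp add: Y.norm_dual_ball_le)
    also have "\<dots> \<le> norm T" using y by (rule closure_image_ball_le)
    finally show ?thesis .
  qed
  \<comment> \<open>A point \<open>x\<close> that almost norms \<open>?S\<close> and a functional
    norming \<open>?S x\<close> give a pair in \<open>M\<close>, with evaluation at \<open>x\<close>
    as the bidual element. Orthogonality supplies \<open>norm T \<le> norm ?S\<close>.\<close>
  have approx: "\<exists>(a, b)\<in>M. re (a + c * b) \<ge> norm T - \<epsilon>" if pos: "\<epsilon> > 0" for c \<epsilon>
  proof -
    let ?S = "T + op_scale scaleY c A"
    obtain x where x: "norm x \<le> 1" "norm (blinfun_apply ?S x) \<ge> norm ?S - \<epsilon>"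
      using ex_unit_ball_norm_ge[OF pos] .
    obtain f where f: "f \<in> dual_ball scaleY"
      "blinfun_apply f (blinfun_apply ?S x) = of_real (norm (blinfun_apply ?S x))"
      using Y.ex_norming_functional .
    let ?J = "\<lambda>f. if f \<in> dual scaleX then blinfun_apply f x else 0"
    have "T \<in> bounded_ops scaleX scaleY" "A \<in> bounded_ops scaleX scaleY"
      using T A by (auto simp: compact_ops_def)
    then have "(?J, blinfun_apply T x, blinfun_apply A x) \<in> N"
      using X.evaluation_in_bidual_ball[OF x(1)] x(1) banach_adjoint_in_dual
      by (auto simp: N_def bidual_limits_def intro!: subsetD[OF closure_subset])
    moreover have "blinfun_apply f \<in> P" using f by (simp add: P_def)
    ultimately have mem: "(blinfun_apply f (blinfun_apply T x), blinfun_apply f (blinfun_apply A x)) \<in> M"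
      unfolding M_def
      by (intro image_eqI[of _ _ "((?J, blinfun_apply T x, blinfun_apply A x), blinfun_apply f)"]) auto
    have "blinfun_apply f (blinfun_apply T x) + c * blinfun_apply f (blinfun_apply A x) =
        of_real (norm (blinfun_apply ?S x))"
      using f by (simp add: blinfun.add_left blinfun.add_right dual_ball_def dual_def bounded_ops_def)
    then have "re (blinfun_apply f (blinfun_apply T x) + c * blinfun_apply f (blinfun_apply A x)) =
        norm (blinfun_apply ?S x)"
      by (simp only: re_of_real)
    moreover have "norm T \<le> norm ?S"
      using orth by (simp add: birkhoff_orthogonal_def)
    ultimately have "norm T - \<epsilon> \<le>
        re (blinfun_apply f (blinfun_apply T x) + c * blinfun_apply f (blinfun_apply A x))"
      using x(2) by linarith
    with mem show ?thesis by blast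
  qed
  \<comment> \<open>Strict separation of 0 from the compact hull in the complex plane; the
    separating real functional is rewritten as multiplication by a scalar.\<close>
  obtain c \<delta> where \<delta>: "\<delta> > 0" and sep: "\<And>d. d \<in> ?D \<Longrightarrow> re (c * d) > \<delta>"
  proof -
    have not0: "0 \<notin> convex hull (cembed ` ?D)"
    proof -
      have "cembed (0::'k) \<notin> cembed ` (convex hull ?D)"
        using not by (simp only: inj_image_mem_iff[OF inj_cembed] not_False_eq_True)
      then show ?thesis
        by (simp only: linear_0[OF linear_cembed] convex_hull_linear_image[OF linear_cembed]
            not_False_eq_True)
    qed
    have "closed (convex hull (cembed ` ?D))"
      by (intro compact_imp_closed compact_convex_hull compact_continuous_image cD
          continuous_on_cembed continuous_on_id)
    from separating_hyperplane_closed_0[OF convex_convex_hull this not0]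
    obtain a \<delta> where a: "0 < \<delta>" "\<And>x. x \<in> convex hull (cembed ` ?D) \<Longrightarrow> inner a x > \<delta>"
      by (elim exE conjE) blast
    have "linear (\<lambda>d::'k. inner a (cembed d))"
      by (rule linearI) (simp_all add: inner_add_right)
    then obtain w where w: "\<And>d::'k. inner a (cembed d) = re (d * w)"
      by (rule linear_functional_re_mult) blast
    show ?thesis
    proof (rule that[OF a(1)])
      fix d assume "d \<in> ?D"
      then have "inner a (cembed d) > \<delta>" by (intro a(2) hull_inc imageI)
      then show "re (w * d) > \<delta>" by (simp add: w mult.commute)
    qed
  qed
  define \<epsilon> where "\<epsilon> n = inverse (real (Suc n))" for n
  have \<epsilon>: "\<epsilon> n > 0" for n by (simp add: \<epsilon>_def)
  \<comment> \<open>The tolerance is the square of the step, so that an error of only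
    \<open>\<epsilon> n\<close> is left after division by \<open>\<epsilon> n\<close>.\<close>
  have "\<exists>p\<in>M. re (fst p - (\<epsilon> n *\<^sub>R c) * snd p) \<ge> norm T - \<epsilon> n * \<epsilon> n" for n
    using approx[of "\<epsilon> n * \<epsilon> n" "- (\<epsilon> n *\<^sub>R c)"] \<epsilon>[of n] by force
  then obtain p where p: "\<And>n. p n \<in> M"
    "\<And>n. re (fst (p n) - (\<epsilon> n *\<^sub>R c) * snd (p n)) \<ge> norm T - \<epsilon> n * \<epsilon> n"
    by metis
  have p': "re (fst (p n)) - \<epsilon> n * re (c * snd (p n)) \<ge> norm T - \<epsilon> n * \<epsilon> n" for n
    using p(2)[of n] by simp
  have small: "re (c * snd (p n)) \<le> \<epsilon> n" for n
  proof -
    have "re (fst (p n)) \<le> norm T"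
      using M_le[of "fst (p n)" "snd (p n)"] p(1)[of n] re_le_norm[of "fst (p n)"] by simp
    then have "\<epsilon> n * re (c * snd (p n)) \<le> \<epsilon> n * \<epsilon> n" using p'[of n] by linarith
    then show ?thesis using \<epsilon> by simp
  qed
  \<comment> \<open>\<open>M\<close> lies in a metric space, so sequences suffice although the
    bidual ball need not be metrizable.\<close>
  obtain l \<sigma> where l: "l \<in> M" and \<sigma>: "strict_mono \<sigma>" and lim: "(p \<circ> \<sigma>) \<longlonglongrightarrow> l"
    using cM p(1) unfolding compact_eq_seq_compact_metric seq_compact_def by metis
  have re_tendsto: "(\<lambda>n. re (u n)) \<longlonglongrightarrow> re u0" if "u \<longlonglongrightarrow> u0" for u :: "nat \<Rightarrow> 'k" and u0
    using that unfolding re_def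
    by (intro tendsto_Re bounded_linear.tendsto[OF bounded_linear_cembed])
  have f: "(\<lambda>n. re (fst (p (\<sigma> n)))) \<longlonglongrightarrow> re (fst l)"
    and s: "(\<lambda>n. re (c * snd (p (\<sigma> n)))) \<longlonglongrightarrow> re (c * snd l)"
    using lim by (auto intro!: re_tendsto tendsto_intros simp: o_def)
  have e: "(\<lambda>n. \<epsilon> (\<sigma> n)) \<longlonglongrightarrow> 0"
    using LIMSEQ_subseq_LIMSEQ[OF LIMSEQ_inverse_real_of_nat \<sigma>] by (simp add: \<epsilon>_def o_def)
  have "re (c * snd l) \<le> 0"
    using s e by (rule LIMSEQ_le) (use small in blast)
  moreover have "norm T \<le> re (fst l)"
  proof -
    have "(\<lambda>n. norm T - \<epsilon> (\<sigma> n) * \<epsilon> (\<sigma> n)) \<longlonglongrightarrow> norm T - 0 * 0"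
      "(\<lambda>n. re (fst (p (\<sigma> n))) - \<epsilon> (\<sigma> n) * re (c * snd (p (\<sigma> n)))) \<longlonglongrightarrow> re (fst l) - 0 * re (c * snd l)"
      by (intro tendsto_intros e f s)+
    then have "norm T - 0 * 0 \<le> re (fst l) - 0 * re (c * snd l)"
      by (rule LIMSEQ_le) (use p' in blast)
    then show ?thesis by simp
  qed
  then have "fst l = of_real (norm T)"
    using M_le[of "fst l" "snd l"] l by (intro eq_of_real_if_re_ge_norm) auto
  then have "snd l \<in> ?D" using l unfolding D by blast
  then have "re (c * snd l) > \<delta>" by (rule sep)
  ultimately show False using \<delta> by linarith
qed

section \<open>Passage to extreme points, and the converse by a half-plane\<close>

theorem proposition3p10:
  fixes scaleX :: "'k::real_or_complex \<Rightarrow> 'x::banach \<Rightarrow> 'x"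
    and scaleY :: "'k \<Rightarrow> 'y::banach \<Rightarrow> 'y"
    and T A :: "'x \<Rightarrow>\<^sub>L 'y"
  assumes "banach_over scaleX" and "banach_over scaleY"
    and "T \<in> compact_ops scaleX scaleY" and "A \<in> compact_ops scaleX scaleY"
  shows "birkhoff_orthogonal (op_scale scaleY) T A \<longleftrightarrow>
    0 \<in> convex hull {\<phi> (banach_adjoint A f) |\<phi> f.
      \<phi> extreme_point_of (bidual_ball scaleX) \<and>
      f extreme_point_of (dual_ball scaleY) \<and>
      \<phi> (banach_adjoint T f) = of_real (norm T)}"
    (is "_ \<longleftrightarrow> 0 \<in> convex hull ?E")
proof -
  interpret X: banach_over scaleX by fact
  interpret Y: banach_over scaleY by fact
  have bd: "T \<in> bounded_ops scaleX scaleY" "A \<in> bounded_ops scaleX scaleY"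
    using assms(3,4) by (auto simp: compact_ops_def)
  show ?thesis
  proof
    assume "birkhoff_orthogonal (op_scale scaleY) T A"
    from zero_in_hull_limit_values[OF assms this]
    have "0 \<in> convex hull {blinfun_apply f z |\<phi> y z f. (\<phi>, y, z) \<in> bidual_limits scaleX scaleY T A \<and>
       f \<in> dual_ball scaleY \<and> blinfun_apply f y = of_real (norm T)}" (is "0 \<in> convex hull ?D") .
    also have "convex hull ?D \<subseteq> convex hull ?E"
    proof (rule hull_minimal, clarify)
      fix \<phi> y z f
      assume n: "(\<phi>, y, z) \<in> bidual_limits scaleX scaleY T A"
        and f: "f \<in> dual_ball scaleY" "blinfun_apply f y = of_real (norm T)"
      have \<phi>: "\<phi> \<in> bidual_ball scaleX" and y: "norm y \<le> norm T"
        using n closure_image_ball_le by (auto simp: bidual_limits_def)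
      \<comment> \<open>With \<open>\<phi>\<close>, \<open>y\<close>, \<open>z\<close> fixed,
        \<open>f\<close> may be replaced by extreme functionals \<open>e\<close> attaining
        \<open>norm T\<close> at \<open>y\<close>. For each of these \<open>\<phi>\<close> still
        attains \<open>norm T\<close> at \<open>banach_adjoint T e\<close>.\<close>
      have "blinfun_apply e z \<in> convex hull ?E"
        if e: "e extreme_point_of dual_ball scaleY" "blinfun_apply e y = of_real (norm T)" for e
      proof -
        have e': "e \<in> dual scaleY" "norm e \<le> 1"
          using e(1) by (auto simp: extreme_point_of_def dual_ball_def)
        then have ev: "\<phi> (banach_adjoint T e) = blinfun_apply e y" "\<phi> (banach_adjoint A e) = blinfun_apply e z"
          using n by (auto simp: bidual_limits_def)
        \<comment> \<open>Now \<open>e\<close> is fixed and \<open>\<phi>\<close> varies: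
          \<open>norm T\<close> bounds the norm of \<open>banach_adjoint T e\<close>, so attaining
          it defines a face of the bidual ball.\<close>
        have "\<phi> (banach_adjoint A e) \<in> convex hull {\<psi> (banach_adjoint A e) |\<psi>.
            \<psi> extreme_point_of bidual_ball scaleX \<and> \<psi> (banach_adjoint T e) = of_real (norm T)}"
          using banach_adjoint_in_dual[OF bd(1) e'(1)] \<phi> norm_banach_adjoint_le[OF e'(2)] e(2) ev(1)
          by (intro X.bidual_evaluation_mem_hull) simp_all
        also have "\<dots> \<subseteq> convex hull ?E"
          using e(1) by (intro hull_mono) blast
        finally show ?thesis by (simp only: ev)
      qed
      then have "convex hull {blinfun_apply e z |e. e extreme_point_of dual_ball scaleY \<and>
          blinfun_apply e y = of_real (norm T)} \<subseteq> convex hull ?E"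
        by (intro hull_minimal convex_convex_hull) blast
      with Y.dual_evaluation_mem_hull[OF f(1) y f(2)] show "blinfun_apply f z \<in> convex hull ?E"
        by blast
    qed (rule convex_convex_hull)
    finally show "0 \<in> convex hull ?E" .
  next
    assume zero: "0 \<in> convex hull ?E"
    show "birkhoff_orthogonal (op_scale scaleY) T A"
      unfolding birkhoff_orthogonal_def
    proof
      fix c
      let ?S = "T + op_scale scaleY c A"
      let ?H = "{w. re (c * w) \<le> norm ?S - norm T}"
      \<comment> \<open>On \<open>?E\<close> the functional \<open>\<phi>\<close> takes the value
        \<open>norm T\<close> at the adjoint of \<open>T\<close>, so the bound by
        \<open>norm ?S\<close> at the adjoint of \<open>?S\<close> leaves
        \<open>norm ?S - norm T\<close> for the \<open>A\<close> term.\<close>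
      have "?E \<subseteq> ?H"
      proof clarify
        fix \<phi> f
        assume \<phi>: "\<phi> extreme_point_of bidual_ball scaleX" and "f extreme_point_of dual_ball scaleY"
          and T: "\<phi> (banach_adjoint T f) = of_real (norm T)"
        then have f: "f \<in> dual scaleY" "norm f \<le> 1" and \<phi>': "\<phi> \<in> bidual_ball scaleX"
          by (auto simp: extreme_point_of_def dual_ball_def)
        note adj = banach_adjoint_in_dual[OF bd(1) f(1)] banach_adjoint_in_dual[OF bd(2) f(1)]
        have sc: "op_scale (*) c (banach_adjoint A f) \<in> dual scaleX"
          using adj(2) by (simp add: dual_def bounded_ops_def algebra_simps)
        have "of_real (norm T) + c * \<phi> (banach_adjoint A f) = \<phi> (banach_adjoint ?S f)"
          using \<phi>' adj sc T
          by (simp add: banach_adjoint_add_op_scale[OF f(1) assms(2)] bidual_ball_def bidual_def)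
        then have "norm T + re (c * \<phi> (banach_adjoint A f)) = re (\<phi> (banach_adjoint ?S f))"
          by (metis re_add re_of_real)
        also have "\<dots> \<le> norm (\<phi> (banach_adjoint ?S f))" by (rule re_le_norm)
        also have "\<dots> \<le> norm (banach_adjoint ?S f)"
        proof -
          have "banach_adjoint ?S f \<in> dual scaleX"
            using adj(1) sc unfolding banach_adjoint_add_op_scale[OF f(1) assms(2)]
            by (simp add: dual_def bounded_ops_def blinfun.add_left distrib_left)
          then show ?thesis using \<phi>' by (simp add: X.bidual_ball_iff)
        qed
        also have "\<dots> \<le> norm ?S" by (rule norm_banach_adjoint_le[OF f(2)])
        finally show "re (c * \<phi> (banach_adjoint A f)) \<le> norm ?S - norm T" by simp
      qed
      moreover have "convex ?H"
      proof -
        have "linear (\<lambda>w. re (c * w))" by (rule linearI) (simp_all add: distrib_left)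
        from convex_linear_vimage[OF this, of "{..norm ?S - norm T}"] show ?thesis
          by (simp add: vimage_def)
      qed
      ultimately have "convex hull ?E \<subseteq> ?H" by (rule hull_minimal)
      then have "re (c * 0) \<le> norm ?S - norm T" using zero by blast
      then show "norm T \<le> norm ?S" by (simp add: linear_0[OF linear_re])
    qed
  qed
qed

end
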